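(* Let $G=C_n$ with $n\ge 3$, or let $G=D_n$ with $n\ge 4$. Then there exists a simplicial surface $X_G$ with automorphism group $\mathrm{Aut}(X_G)$ isomorphic to $G$ such that $X_G$ can be embedded into $\mathbb{R}^3$ with equilateral triangles.
   Context: $C_n$ is the cyclic group of order $n$ and $D_n$ is the dihedral group of order $2n$. A (closed) simplicial surface $(X,<)$ is a countable set $X$ partitioned into non-empty sets $X_0$ (vertices), $X_1$ (edges), $X_2$ (faces), together with a relation $<$ (incidence), a subset of $(X_0\times X_1)\cup(X_1\times X_2)\cup(X_0\times X_2)$, such that: (1) for each edge $e\in X_1$ there are exactly two vertices $V\in X_0$ with $V<e$; (2) for each face $F\in X_2$ there are exactly three edges $e\in X_1$ with $e<F$ and exactly three vertices $V\in X_0$ with $V<F$, and each of these three vertices is incident to exactly two of these three edges; (3) for each edge $e\in X_1$ there are exactly two faces $F\in X_2$ with $e<F$; (4) (umbrella condition) for each vertex $V\in X_0$ the number $n=\deg(V)$ of faces $F\in X_2$ with $V<F$ satisfies $3\le \deg(V)<\infty$, and these faces can be arranged in a sequence $(F_1,\dots,F_n)$ such that, with $F_{n+1}=F_1$, the faces $F_i$ and $F_{i+1}$ share a common edge $e_i$ with $V<e_i$ for $i=1,\dots,n$. A homomorphism $\pi:X\to Y$ of simplicial surfaces is a map such that $A<_X B$ implies $\pi(A)<_Y\pi(B)$, and such that for every face $F$ the restriction of $\pi$ to the vertices and edges incident to $F$ is an isomorphism onto the set of vertices and edges incident to $\pi(F)$. $\mathrm{Aut}(X)$ is the group of automorphisms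 of $X$, i.e. invertible homomorphisms $X\to X$ (equivalently, permutations of $X$ preserving each of $X_0,X_1,X_2$ and preserving the incidence relation in both directions). An embedding of $X$ with equilateral triangles is a map $\phi:X_0\to\mathbb{R}^3$ such that $\|\phi(v_1)-\phi(v_2)\|^2=1$ (Euclidean norm) whenever $v_1,v_2$ are the two vertices incident to a common edge of $X$. *)

theory Defs
  imports
    "HOL-Analysis.Analysis"
    "HOL-Algebra.Bij"
    "HOL-Algebra.Elementary_Groups"
begin

section \<open>Simplicial surfaces\<close>

record 'a incidence_structure =
  verts :: "'a set"
  edges :: "'a set"
  faces :: "'a set"
  inc :: "('a \<times> 'a) set"

definition cells :: "('a, 'm) incidence_structure_scheme \<Rightarrow> 'a set" where
  "cells X = verts X \<union> edges X \<union> faces X"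

definition faces_at :: "('a, 'm) incidence_structure_scheme \<Rightarrow> 'a \<Rightarrow> 'a set" where
  "faces_at X V = {F \<in> faces X. (V, F) \<in> inc X}"

text \<open>
  In the umbrella condition the list \<open>Fs\<close> enumerates the faces at \<open>V\<close> without repetition,
  so that its length is the degree of \<open>V\<close>; indices are read cyclically.
  Connectedness is not required, and \<open>cells X\<close> may be infinite.
\<close>

locale simplicial_surface =
  fixes X :: "('a, 'm) incidence_structure_scheme"
  assumes countable_cells: "countable (cells X)"
    and nonempty: "verts X \<noteq> {}" "edges X \<noteq> {}" "faces X \<noteq> {}"
    and disjoint: "verts X \<inter> edges X = {}" "verts X \<inter> faces X = {}" "edges X \<inter> faces X = {}"
    and inc_subset:
      "inc X \<subseteq> verts X \<times> edges X \<union> edges X \<times> faces X \<union> verts X \<times> faces X"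
    and edge_verts: "e \<in> edges X \<Longrightarrow> card {V \<in> verts X. (V, e) \<in> inc X} = 2"
    and face_edges: "F \<in> faces X \<Longrightarrow> card {e \<in> edges X. (e, F) \<in> inc X} = 3"
    and face_verts: "F \<in> faces X \<Longrightarrow> card {V \<in> verts X. (V, F) \<in> inc X} = 3"
    and face_corner: "\<lbrakk>F \<in> faces X; V \<in> verts X; (V, F) \<in> inc X\<rbrakk> \<Longrightarrow>
      card {e \<in> edges X. (e, F) \<in> inc X \<and> (V, e) \<in> inc X} = 2"
    and edge_faces: "e \<in> edges X \<Longrightarrow> card {F \<in> faces X. (e, F) \<in> inc X} = 2"
    and finite_degree: "V \<in> verts X \<Longrightarrow> finite (faces_at X V)"
    and degree_ge_3: "V \<in> verts X \<Longrightarrow> 3 \<le> card (faces_at X V)"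
    and umbrella: "V \<in> verts X \<Longrightarrow>
      \<exists>Fs. distinct Fs \<and> set Fs = faces_at X V \<and>
        (\<forall>i < length Fs. \<exists>e \<in> edges X. (V, e) \<in> inc X \<and>
          (e, Fs ! i) \<in> inc X \<and> (e, Fs ! (Suc i mod length Fs)) \<in> inc X)"

section \<open>Homomorphisms and the automorphism group\<close>

definition boundary :: "('a, 'm) incidence_structure_scheme \<Rightarrow> 'a \<Rightarrow> 'a set" where
  "boundary X F = {A \<in> verts X \<union> edges X. (A, F) \<in> inc X}"

text \<open>
  An isomorphism between boundaries of faces is a bijection that preserves and reflects incidence.
\<close>

definition surface_hom ::
  "('a, 'm) incidence_structure_scheme \<Rightarrow> ('b, 'k) incidence_structure_scheme \<Rightarrow> ('a \<Rightarrow> 'b) set"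
  where
  "surface_hom X Y = {\<pi>. \<pi> \<in> cells X \<rightarrow> cells Y \<and>
     (\<forall>A \<in> cells X. \<forall>B \<in> cells X. (A, B) \<in> inc X \<longrightarrow> (\<pi> A, \<pi> B) \<in> inc Y) \<and>
     (\<forall>F \<in> faces X.
        bij_betw \<pi> (boundary X F) (boundary Y (\<pi> F)) \<and>
        (\<forall>A \<in> boundary X F. \<forall>B \<in> boundary X F. (A, B) \<in> inc X \<longleftrightarrow> (\<pi> A, \<pi> B) \<in> inc Y))}"

definition Aut :: "('a, 'm) incidence_structure_scheme \<Rightarrow> ('a \<Rightarrow> 'a) monoid" where
  "Aut X = BijGroup (cells X)
     \<lparr>carrier := {\<pi> \<in> Bij (cells X).
        \<pi> \<in> surface_hom X X \<and> inv_into (cells X) \<pi> \<in> surface_hom X X}\<rparr>"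

section \<open>Embeddings with equilateral triangles\<close>

definition equilateral_embedding ::
  "('a, 'm) incidence_structure_scheme \<Rightarrow> ('a \<Rightarrow> real ^ 3) \<Rightarrow> bool" where
  "equilateral_embedding X \<phi> \<longleftrightarrow>
     (\<forall>e \<in> edges X. \<forall>v\<^sub>1 \<in> verts X. \<forall>v\<^sub>2 \<in> verts X.
        v\<^sub>1 \<noteq> v\<^sub>2 \<and> (v\<^sub>1, e) \<in> inc X \<and> (v\<^sub>2, e) \<in> inc X \<longrightarrow> (norm (\<phi> v\<^sub>1 - \<phi> v\<^sub>2))\<^sup>2 = 1)"

section \<open>Dihedral groups\<close>

text \<open>
  The dihedral group of order \<open>2n\<close> as the semidirect product of the integers modulo \<open>n\<close> with a
  group of order two acting by inversion: \<open>(a, s)\<close> stands for \<open>r\<^sup>a\<close> if \<open>s\<close> is false and for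
  \<open>r\<^sup>a t\<close> if \<open>s\<close> is true, where \<open>r\<close> is a rotation of order \<open>n\<close>, \<open>t\<close> a reflection,
  and \<open>t r t = r\<^sup>-\<^sup>1\<close>.
\<close>

definition dihedral_group :: "nat \<Rightarrow> (int \<times> bool) monoid" where
  "dihedral_group n =
     \<lparr>carrier = carrier (integer_mod_group n) \<times> UNIV,
      mult = (\<lambda>(a, s) (b, t). ((a + (if s then - b else b)) mod int n, s \<noteq> t)),
      one = (0, False)\<rparr>"

lemma order_dihedral_group:
  assumes "n > 0"
  shows "order (dihedral_group n) = 2 * n"
  using assms
  by (simp add: order_def dihedral_group_def carrier_integer_mod_group card_cartesian_product)

lemma group_dihedral_group:
  assumes "n > 0"
  shows "group (dihedral_group n)"
proof (rule groupI, goal_cases)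
  case (5 x)
  obtain a s where [simp]: "x = (a, s)" by (cases x)
  have "a \<in> {0..<int n}"
    using 5 assms by (auto simp: dihedral_group_def carrier_integer_mod_group)
  then show ?case
    using assms
    by (intro bexI[of _ "if s then (a, s) else ((- a) mod int n, s)"])
       (auto simp: dihedral_group_def carrier_integer_mod_group mod_simps)
qed (use assms in \<open>auto simp: dihedral_group_def carrier_integer_mod_group mod_simps algebra_simps\<close>)

end

theory Submission
  imports Defs
begin

text \<open>
  The map of an embedding with equilateral triangles may identify vertices that are not adjacent.
  Hence every surface with a proper vertex colouring in four colours embeds: send the colours to
  the corners of a regular tetrahedron of edge length one (\<open>four_colouring_embedding\<close>). It
  remains to find a four-colourable surface with the prescribed automorphism group.

  Fix \<open>m\<close> and \<open>n\<close> and take a sphere made of a polygon with \<open>m n\<close> sides, its rim, closed off by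
  two triangulated discs. One disc is the cone with an apex \<open>N\<close> over the rim. In the other one
  every \<open>m\<close>-th rim vertex, called a corner, is joined to a vertex \<open>S\<close>, consecutive corners are
  joined to each other, and the polygon cut off by two consecutive corners \<open>c, c'\<close> (with \<open>m - 1\<close>
  rim vertices in between) is triangulated by the diagonals from \<open>c\<close>.

  Let \<open>m = 2\<close> and \<open>n \<ge> 4\<close>, or \<open>m = 3\<close> and \<open>n \<ge> 3\<close>. Then the degree \<open>m n\<close> of the apex is larger than
  all other degrees, so every automorphism fixes the apex and acts on its link, the rim, as a
  rotation or a reflection of a cycle. It also fixes \<open>S\<close>, the only vertex outside the cone, and therefore permutes the corners, so that rotations are by multiples
  of \<open>m\<close> (\<open>simplicial_is_act\<close>). For \<open>m = 2\<close> a single triangle is cut off between consecutive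
  corners; it is symmetric, all rotations and reflections of the corners are realised, and the
  group is dihedral. For \<open>m = 3\<close> the quadrangle between \<open>c\<close> and \<open>c'\<close> has its diagonal at \<open>c\<close>
  and not at \<open>c'\<close>; this chirality kills the reflections and leaves the cyclic group. With \<open>m = 2\<close> the
  corners have degree six, which differs from the degree \<open>2 n\<close> of the apex exactly if \<open>n \<noteq> 3\<close>.

  Two general tools make this rigorous. A finite set of triangles in which the link of every vertex is
  a cycle yields a simplicial surface (\<open>triangulated_surface.simplicial_surface\<close>), and the
  automorphisms of that surface are the vertex maps that preserve the set of triangles
  (\<open>Aut_iso_of_full_action\<close>).
\<close>

section \<open>Surfaces from complexes whose vertex links are cycles\<close>

definition cyclic_pair :: "'a list \<Rightarrow> nat \<Rightarrow> 'a set" where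
  "cyclic_pair us k = {us ! k, us ! (Suc k mod length us)}"

definition link_cycle :: "'a set set \<Rightarrow> 'a \<Rightarrow> 'a list \<Rightarrow> bool" where
  "link_cycle T v us \<longleftrightarrow> distinct us \<and> 3 \<le> length us \<and> v \<notin> set us \<and>
     {t \<in> T. v \<in> t} = (\<lambda>k. insert v (cyclic_pair us k)) ` {..<length us}"

text \<open>
  In a cycle of length at least three an edge determines its position: two distinct positions with
  the same edge would have to be successors of each other.
\<close>

lemma cyclic_pair_eq_iff:
  assumes "distinct us" "3 \<le> length us" "i < length us" "j < length us"
  shows "cyclic_pair us i = cyclic_pair us j \<longleftrightarrow> i = j"
proof
  assume eq: "cyclic_pair us i = cyclic_pair us j"
  let ?s = "\<lambda>k. Suc k mod length us"
  have lt: "?s i < length us" "?s j < length us"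
    using assms(3) by (auto intro!: mod_less_divisor)
  have "i = j \<or> i = ?s j \<and> ?s i = j"
    using eq assms lt unfolding cyclic_pair_def doubleton_eq_iff by (auto simp: nth_eq_iff_index_eq)
  then show "i = j"
    using assms by (auto simp: mod_Suc split: if_splits)
qed auto

lemma star_inj:
  assumes "link_cycle T v us" "i < length us" "j < length us"
    "insert v (cyclic_pair us i) = insert v (cyclic_pair us j)"
  shows "i = j"
proof -
  have *: "distinct us" "3 \<le> length us" "v \<notin> set us"
    using assms(1) unfolding link_cycle_def by auto
  have "Suc k mod length us < length us" for k
    using *(2) by (intro mod_less_divisor) auto
  then have "v \<notin> cyclic_pair us i" "v \<notin> cyclic_pair us j"
    using * assms(2,3) unfolding cyclic_pair_def by (metis nth_mem insertE singletonD)+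
  then have "cyclic_pair us i = cyclic_pair us j"
    using assms(4) by auto
  then show ?thesis
    using cyclic_pair_eq_iff * assms(2,3) by blast
qed

lemma card_star:
  assumes "link_cycle T v us"
  shows "card {t \<in> T. v \<in> t} = length us"
proof -
  have "inj_on (\<lambda>k. insert v (cyclic_pair us k)) {..<length us}"
    using star_inj[OF assms] by (auto intro: inj_onI)
  then show ?thesis
    using assms card_image unfolding link_cycle_def by fastforce
qed

text \<open>
  For an explicit list this form of the condition is evaluated by rewriting.
\<close>

lemma link_cycle_iff_zip:
  "link_cycle T v us \<longleftrightarrow> distinct us \<and> 3 \<le> length us \<and> v \<notin> set us \<and>
     {t \<in> T. v \<in> t} = (\<lambda>(a, b). {v, a, b}) ` set (zip us (rotate1 us))"
proof -
  have "(\<lambda>k. insert v (cyclic_pair us k)) ` {..<length us} =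
      (\<lambda>(a, b). {v, a, b}) ` set (zip us (rotate1 us))"
    unfolding set_zip cyclic_pair_def by (force simp: nth_rotate1)
  then show ?thesis
    unfolding link_cycle_def by simp
qed

text \<open>
  Cycles of variable length are given by a periodic sequence on the integers, which avoids the wrap-around
  of indices.
\<close>

lemma link_cycle_periodic:
  fixes p :: "int \<Rightarrow> 'a" and L :: int
  assumes "3 \<le> L" and p: "\<And>a b. p a = p b \<longleftrightarrow> a mod L = b mod L"
    and v: "\<And>k. p k \<noteq> v"
    and star: "{t \<in> T. v \<in> t} = {{v, p k, p (k + 1)} | k. True}"
  shows "link_cycle T v (map (\<lambda>k. p (int k)) [0..<nat L])"
proof -
  let ?us = "map (\<lambda>k. p (int k)) [0..<nat L]"
  have pair: "cyclic_pair ?us k = {p (int k), p (int k + 1)}" if "k < nat L" for k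
  proof -
    have "Suc k mod nat L < nat L"
      using assms(1) by simp
    then have "?us ! (Suc k mod nat L) = p (int (Suc k mod nat L))"
      by simp
    also have "\<dots> = p (int k + 1)"
      using assms(1) unfolding p by (simp add: zmod_int add.commute)
    finally show ?thesis
      using that unfolding cyclic_pair_def by simp
  qed
  have "{{v, p k, p (k + 1)} | k. True} = (\<lambda>k. insert v (cyclic_pair ?us k)) ` {..<nat L}"
  proof (intro subset_antisym subsetI)
    fix t assume "t \<in> {{v, p k, p (k + 1)} | k. True}"
    then obtain k where t: "t = {v, p k, p (k + 1)}"
      by blast
    have "p (int (nat (k mod L))) = p k" "p (int (nat (k mod L)) + 1) = p (k + 1)"
      using assms(1) unfolding p by (auto simp: mod_simps)
    moreover have "nat (k mod L) < nat L"
      using assms(1) by simp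
    ultimately show "t \<in> (\<lambda>k. insert v (cyclic_pair ?us k)) ` {..<nat L}"
      unfolding t using pair by (intro image_eqI[of _ _ "nat (k mod L)"]) auto
  next
    fix t assume "t \<in> (\<lambda>k. insert v (cyclic_pair ?us k)) ` {..<nat L}"
    then show "t \<in> {{v, p k, p (k + 1)} | k. True}"
      using pair by auto
  qed
  moreover have "distinct ?us"
    using p unfolding distinct_map inj_on_def by auto
  ultimately show ?thesis
    using assms(1) v star unfolding link_cycle_def by force
qed

definition simplices :: "'a set set \<Rightarrow> nat \<Rightarrow> 'a set set" where
  "simplices T d = {A. card A = d \<and> (\<exists>t\<in>T. A \<subseteq> t)}"

text \<open>
  Finite sets of naturals are encoded as naturals by \<open>set_encode\<close>, so the simplices themselves become
  the cells, and incidence becomes strict inclusion.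
\<close>

definition surface_of :: "nat set set \<Rightarrow> nat incidence_structure" where
  "surface_of T = \<lparr>verts = set_decode -` simplices T 1, edges = set_decode -` simplices T 2,
     faces = set_decode -` simplices T 3,
     inc = {(a, b). set_decode a \<in> simplices T 1 \<union> simplices T 2 \<union> simplices T 3 \<and>
       set_decode b \<in> simplices T 1 \<union> simplices T 2 \<union> simplices T 3 \<and>
       set_decode a \<subset> set_decode b}\<rparr>"

lemma card_vimage_set_decode:
  assumes "\<And>A. A \<in> \<A> \<Longrightarrow> finite A"
  shows "card (set_decode -` \<A>) = card \<A>"
proof (rule card_vimage_inj)
  show "inj set_decode"
    by (metis injI set_decode_inverse)
  show "\<A> \<subseteq> range set_decode"
    using assms by (metis rangeI set_encode_inverse subsetI)
qed

text \<open>
  That all triangles have three vertices, and all edges two triangles, is a consequence of the condition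
  on links.
\<close>

locale triangulated_surface =
  fixes T :: "nat set set"
  assumes finite_T: "finite T"
    and T_nonempty: "T \<noteq> {}" "{} \<notin> T"
    and link: "v \<in> \<Union>T \<Longrightarrow> \<exists>us. link_cycle T v us"
begin

lemma obtain_link:
  assumes "t \<in> T" "v \<in> t"
  obtains us k where "link_cycle T v us" "k < length us" "t = insert v (cyclic_pair us k)"
proof -
  obtain us where us: "link_cycle T v us"
    using link assms by blast
  then have "t \<in> (\<lambda>k. insert v (cyclic_pair us k)) ` {..<length us}"
    using assms unfolding link_cycle_def by blast
  then show thesis
    using us that by auto
qed

lemma card_triangle:
  assumes "t \<in> T"
  shows "card t = 3"
proof -
  obtain v where "v \<in> t"
    using assms T_nonempty by fastforce
  then obtain us k where us: "link_cycle T v us" "k < length us" "t = insert v (cyclic_pair us k)"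
    using obtain_link assms by metis
  have *: "distinct us" "3 \<le> length us" "v \<notin> set us"
    using us(1) unfolding link_cycle_def by auto
  let ?k = "Suc k mod length us"
  have k: "?k < length us" "?k \<noteq> k"
    using *(2) us(2) by (auto simp: mod_Suc)
  then have "us ! k \<noteq> us ! ?k" "us ! k \<noteq> v" "us ! ?k \<noteq> v"
    using * us(2) by (metis nth_eq_iff_index_eq nth_mem)+
  then show ?thesis
    using us(3) unfolding cyclic_pair_def by auto
qed

lemma finite_triangle: "t \<in> T \<Longrightarrow> finite t"
  using card_triangle by (metis card.infinite zero_neq_numeral)

lemma simplices_3: "simplices T 3 = T"
proof
  show "simplices T 3 \<subseteq> T"
  proof
    fix A assume "A \<in> simplices T 3"
    then obtain t where "t \<in> T" "A \<subseteq> t" "card A = card t"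
      using card_triangle unfolding simplices_def by auto
    then show "A \<in> T"
      using card_subset_eq finite_triangle by metis
  qed
qed (auto simp: simplices_def card_triangle)

lemma simplices_1: "simplices T 1 = {{v} | v. v \<in> \<Union>T}"
  unfolding simplices_def by (auto simp: card_1_singleton_iff)

lemma simplex_subset:
  "A \<in> simplices T d \<Longrightarrow> B \<subseteq> A \<Longrightarrow> B \<in> simplices T (card B)"
  unfolding simplices_def by blast

text \<open>
  The triangles at \<open>{v, w}\<close> correspond to the edges at \<open>w\<close> in the link of \<open>v\<close>, that is, to the position
  of \<open>w\<close> in the cycle and the position before it.
\<close>

lemma card_edge_star:
  assumes "e \<in> simplices T 2"
  shows "card {t \<in> T. e \<subseteq> t} = 2"
proof -
  obtain v w t where e: "e = {v, w}" "v \<noteq> w" "t \<in> T" "v \<in> t" "w \<in> t"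
    using assms unfolding simplices_def by (auto simp: card_2_iff)
  obtain us k where us: "link_cycle T v us" "k < length us" "t = insert v (cyclic_pair us k)"
    using obtain_link e by metis
  have *: "distinct us" "3 \<le> length us" "v \<notin> set us"
    and star: "{t \<in> T. v \<in> t} = (\<lambda>k. insert v (cyclic_pair us k)) ` {..<length us}"
    using us(1) unfolding link_cycle_def by auto
  let ?L = "length us"
  have s: "Suc j mod ?L < ?L" for j
    using *(2) by (intro mod_less_divisor) auto
  obtain j where j: "j < ?L" "w = us ! j"
    using us e(2,5) s unfolding cyclic_pair_def by blast
  define p where "p = (if j = 0 then ?L - 1 else j - 1)"
  have p: "p < ?L" "p \<noteq> j"
    using *(2) j(1) unfolding p_def by auto
  have in_iff: "w \<in> insert v (cyclic_pair us i) \<longleftrightarrow> i = j \<or> i = p" if i: "i < ?L" for i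
  proof -
    have "w \<in> insert v (cyclic_pair us i) \<longleftrightarrow> j = i \<or> j = Suc i mod ?L"
      using e(2) j i s[of i] * unfolding cyclic_pair_def by (auto simp: nth_eq_iff_index_eq)
    also have "\<dots> \<longleftrightarrow> i = j \<or> i = p"
      using i j *(2) unfolding p_def by (auto simp: mod_Suc)
    finally show ?thesis .
  qed
  have "{t \<in> T. e \<subseteq> t} = {t \<in> {t \<in> T. v \<in> t}. w \<in> t}"
    using e(1) by auto
  also have "\<dots> = (\<lambda>k. insert v (cyclic_pair us k)) ` {i. i < ?L \<and> w \<in> insert v (cyclic_pair us i)}"
    unfolding star by blast
  also have "{i. i < ?L \<and> w \<in> insert v (cyclic_pair us i)} = {j, p}"
    using in_iff p j by blast
  finally have "{t \<in> T. e \<subseteq> t} = {insert v (cyclic_pair us j), insert v (cyclic_pair us p)}"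
    by simp
  moreover have "insert v (cyclic_pair us j) \<noteq> insert v (cyclic_pair us p)"
    using star_inj[OF us(1) j(1) p(1)] p(2) by blast
  ultimately show ?thesis
    by simp
qed

lemma surface_of_sel:
  "verts (surface_of T) = set_decode -` simplices T 1"
  "edges (surface_of T) = set_decode -` simplices T 2"
  "faces (surface_of T) = set_decode -` T"
  "(a, b) \<in> inc (surface_of T) \<longleftrightarrow> a \<in> cells (surface_of T) \<and> b \<in> cells (surface_of T) \<and>
     set_decode a \<subset> set_decode b"
  unfolding surface_of_def cells_def by (auto simp: simplices_3)

lemma cells_surface_of:
  "cells (surface_of T) = set_decode -` (simplices T 1 \<union> simplices T 2 \<union> simplices T 3)"
  unfolding cells_def surface_of_def by auto

text \<open>
  In this form membership is visibly preserved by maps of triangles.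
\<close>

lemma in_cells_iff:
  "c \<in> cells (surface_of T) \<longleftrightarrow> set_decode c \<noteq> {} \<and> (\<exists>t\<in>T. set_decode c \<subseteq> t)"
proof -
  have "card A \<in> {1,2,3}" if "A \<noteq> {}" "A \<subseteq> t" "t \<in> T" for A t
  proof -
    have "card A \<le> 3"
      using that card_triangle finite_triangle card_mono by metis
    moreover have "card A \<noteq> 0"
      using that finite_triangle finite_subset by (metis card_0_eq)
    ultimately show ?thesis by auto
  qed
  moreover have "c \<in> cells (surface_of T) \<longleftrightarrow>
      card (set_decode c) \<in> {1,2,3} \<and> (\<exists>t\<in>T. set_decode c \<subseteq> t)"
    unfolding cells_surface_of simplices_def by auto
  moreover have "set_decode c \<noteq> {}" if "card (set_decode c) \<in> {1,2,3}"
    using that by (metis card.empty insertE empty_iff zero_neq_numeral zero_neq_one)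
  ultimately show ?thesis
    by blast
qed

lemma inc_iff:
  assumes "b \<in> cells (surface_of T)"
  shows "(a, b) \<in> inc (surface_of T) \<longleftrightarrow> set_decode a \<noteq> {} \<and> set_decode a \<subset> set_decode b"
  using assms unfolding surface_of_sel in_cells_iff by blast

text \<open>
  The counts for edges and faces are numbers of subsets of a set with two or three elements. The link
  cycle at a vertex \<open>v\<close> supplies the umbrella: its \<open>k\<close>-th edge together with \<open>v\<close> is the \<open>k\<close>-th
  face, and consecutive faces share the edge from \<open>v\<close> to the vertex common to both link edges.
\<close>

theorem simplicial_surface: "simplicial_surface (surface_of T)"
proof
  let ?X = "surface_of T"
  have cellI: "c \<in> verts ?X \<Longrightarrow> c \<in> cells ?X" "c \<in> edges ?X \<Longrightarrow> c \<in> cells ?X" 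
    "c \<in> faces ?X \<Longrightarrow> c \<in> cells ?X" for c
    by (auto simp: cells_def)
  have sub: "card {c. set_decode c \<subseteq> A \<and> card (set_decode c) = d} = card A choose d"
    if "finite A" for A :: "nat set" and d
  proof -
    have "card (set_decode -` {B. B \<subseteq> A \<and> card B = d}) = card {B. B \<subseteq> A \<and> card B = d}"
      using that by (intro card_vimage_set_decode) (auto intro: finite_subset)
    then show ?thesis
      using n_subsets[OF that] by (simp add: vimage_def)
  qed
  obtain t where t: "t \<in> T"
    using T_nonempty by auto
  then obtain v w x where vw: "t = {v, w, x}" "v \<noteq> w" "v \<noteq> x" "w \<noteq> x"
    using card_triangle[OF t] by (auto simp: card_3_iff)
  show "countable (cells ?X)" by simp
  have "set_encode {v} \<in> verts ?X" "set_encode {v, w} \<in> edges ?X" "set_encode {v, w, x} \<in> faces ?X"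
  proof -
    have "{v} \<in> simplices T 1" "{v, w} \<in> simplices T 2" "{v, w, x} \<in> T"
      using t vw unfolding simplices_def by auto
    then show "set_encode {v} \<in> verts ?X" "set_encode {v, w} \<in> edges ?X"
      "set_encode {v, w, x} \<in> faces ?X"
      unfolding surface_of_sel vimage_eq by (simp_all only: set_encode_inverse finite.intros)
  qed
  then show "verts ?X \<noteq> {}" "edges ?X \<noteq> {}" "faces ?X \<noteq> {}"
    by auto
  show "verts ?X \<inter> edges ?X = {}" "verts ?X \<inter> faces ?X = {}" "edges ?X \<inter> faces ?X = {}"
    unfolding surface_of_sel simplices_def using card_triangle by auto
  show "inc ?X \<subseteq> verts ?X \<times> edges ?X \<union> edges ?X \<times> faces ?X \<union> verts ?X \<times> faces ?X"
  proof (rule subrelI)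
    fix a b assume "(a, b) \<in> inc ?X"
    then have ab: "a \<in> cells ?X" "b \<in> cells ?X" "set_decode a \<subset> set_decode b"
      unfolding surface_of_sel by auto
    then have "card (set_decode a) < card (set_decode b)"
      by (intro psubset_card_mono) auto
    then show "(a, b) \<in> verts ?X \<times> edges ?X \<union> edges ?X \<times> faces ?X \<union> verts ?X \<times> faces ?X"
      using ab(1,2) card_triangle unfolding cells_def surface_of_sel simplices_def by auto
  qed
  show "card {V \<in> verts ?X. (V, e) \<in> inc ?X} = 2" if e: "e \<in> edges ?X" for e
  proof -
    have E: "set_decode e \<in> simplices T 2" "card (set_decode e) = 2"
      using e unfolding surface_of_sel simplices_def by auto
    have "{V \<in> verts ?X. (V, e) \<in> inc ?X} =
      {c. set_decode c \<subseteq> set_decode e \<and> card (set_decode c) = 1}"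
      using E(2) simplex_subset[OF E(1)] inc_iff[OF cellI(2)[OF e]]
      unfolding surface_of_sel(1) by (auto simp: simplices_def)
    then show ?thesis
      using sub E(2) by simp
  qed
  show "card {e \<in> edges ?X. (e, F) \<in> inc ?X} = 3" if F: "F \<in> faces ?X" for F
  proof -
    have E: "set_decode F \<in> simplices T 3" "card (set_decode F) = 3"
      using F unfolding surface_of_sel simplices_3 using card_triangle by auto
    have "{V \<in> edges ?X. (V, F) \<in> inc ?X} =
      {c. set_decode c \<subseteq> set_decode F \<and> card (set_decode c) = 2}"
      using E(2) simplex_subset[OF E(1)] inc_iff[OF cellI(3)[OF F]]
      unfolding surface_of_sel(2) by (auto simp: simplices_def)
    then show ?thesis
      using sub E(2) by (simp add: choose_two)
  qed
  show "card {V \<in> verts ?X. (V, F) \<in> inc ?X} = 3" if F: "F \<in> faces ?X" for F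
  proof -
    have E: "set_decode F \<in> simplices T 3" "card (set_decode F) = 3"
      using F unfolding surface_of_sel simplices_3 using card_triangle by auto
    have "{V \<in> verts ?X. (V, F) \<in> inc ?X} =
      {c. set_decode c \<subseteq> set_decode F \<and> card (set_decode c) = 1}"
      using E(2) simplex_subset[OF E(1)] inc_iff[OF cellI(3)[OF F]]
      unfolding surface_of_sel(1) by (auto simp: simplices_def)
    then show ?thesis
      using sub E(2) by simp
  qed
  show "card {e \<in> edges ?X. (e, F) \<in> inc ?X \<and> (V, e) \<in> inc ?X} = 2"
    if F: "F \<in> faces ?X" and V: "V \<in> verts ?X" and VF: "(V, F) \<in> inc ?X" for F V
  proof -
    obtain v where v: "set_decode V = {v}"
      using V unfolding surface_of_sel simplices_1 by auto
    have E: "set_decode F \<in> simplices T 3" "card (set_decode F) = 3"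
      using F unfolding surface_of_sel simplices_3 using card_triangle by auto
    have "v \<in> set_decode F"
      using VF v unfolding surface_of_sel by auto
    then have "card (set_decode F - {v}) = 2"
      using E(2) by simp
    then obtain a b where "set_decode F - {v} = {a, b}" "a \<noteq> b"
      unfolding card_2_iff by blast
    then have ab: "set_decode F = {v, a, b}" "a \<noteq> v" "b \<noteq> v" "a \<noteq> b"
      using \<open>v \<in> set_decode F\<close> by auto
    have "{e \<in> edges ?X. (e, F) \<in> inc ?X \<and> (V, e) \<in> inc ?X} = set_decode -` {{v, a}, {v, b}}"
      (is "?L = ?R")
    proof (intro subset_antisym subsetI)
      fix e assume "e \<in> ?L"
      then have e: "card (set_decode e) = 2" "v \<in> set_decode e" "set_decode e \<subseteq> {v, a, b}"
        using v ab unfolding surface_of_sel simplices_def by auto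
      then have "card (set_decode e - {v}) = 1"
        by simp
      then obtain q where "set_decode e - {v} = {q}"
        by (rule card_1_singletonE)
      then have "set_decode e = {v, q}" "q \<noteq> v"
        using e(2) by blast+
      moreover from this have "q \<in> {a, b}"
        using e(3) by blast
      ultimately show "e \<in> ?R"
        by blast
    next
      fix e assume "e \<in> ?R"
      then have e: "set_decode e \<in> {{v, a}, {v, b}}"
        by (rule vimageD)
      have "A \<subseteq> set_decode F \<and> card A = 2" if "A \<in> {{v, a}, {v, b}}" for A
        using that ab by auto
      then have "set_decode e \<subseteq> set_decode F" "card (set_decode e) = 2"
        using e by blast+
      then have "set_decode e \<in> simplices T 2"
        using simplex_subset[OF E(1)] by metis
      then have "e \<in> edges ?X"
        unfolding surface_of_sel by simp
      moreover have "{v} \<subset> set_decode e" "set_decode e \<subset> set_decode F" "set_decode e \<noteq> {}"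
        using e ab by blast+
      ultimately show "e \<in> ?L"
        using inc_iff cellI F v by simp
    qed
    also have "card \<dots> = card {{v, a}, {v, b}}"
      by (intro card_vimage_set_decode) auto
    also have "\<dots> = 2"
      using ab by (auto simp: doubleton_eq_iff)
    finally show ?thesis .
  qed
  show "card {F \<in> faces ?X. (e, F) \<in> inc ?X} = 2" if e: "e \<in> edges ?X" for e
  proof -
    have E: "set_decode e \<in> simplices T 2" "card (set_decode e) = 2"
      using e unfolding surface_of_sel simplices_def by auto
    have "{F \<in> faces ?X. (e, F) \<in> inc ?X} = set_decode -` {t \<in> T. set_decode e \<subseteq> t}"
      using E(2) cellI(3) card_triangle cellI(2)[OF e] by (auto simp: surface_of_sel)
    also have "card \<dots> = 2"
      using finite_triangle card_edge_star[OF E(1)] by (subst card_vimage_set_decode) auto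
    finally show ?thesis .
  qed
  fix V assume V: "V \<in> verts ?X"
  then obtain v where v: "set_decode V = {v}" "v \<in> \<Union>T"
    unfolding surface_of_sel simplices_1 by auto
  have at: "faces_at ?X V = set_decode -` {t \<in> T. v \<in> t}"
    using cellI(1)[OF V] cellI(3) v card_triangle[of "{v}"] unfolding faces_at_def
    by (auto simp: surface_of_sel psubset_eq)
  obtain us where us: "link_cycle T v us"
    using link v by blast
  have *: "distinct us" "3 \<le> length us" "v \<notin> set us"
    and star: "{t \<in> T. v \<in> t} = (\<lambda>k. insert v (cyclic_pair us k)) ` {..<length us}"
    using us unfolding link_cycle_def by auto
  have card: "card (faces_at ?X V) = length us"
    unfolding at using finite_triangle card_star[OF us] by (subst card_vimage_set_decode) auto
  then show "3 \<le> card (faces_at ?X V)"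
    using * by simp
  then show "finite (faces_at ?X V)"
    by (metis card.infinite not_numeral_le_zero)
  let ?L = "length us"
  let ?f = "\<lambda>k. set_encode (insert v (cyclic_pair us k))"
  have fin: "finite (cyclic_pair us k)" for k
    unfolding cyclic_pair_def by simp
  have dec: "set_decode (?f k) = insert v (cyclic_pair us k)" for k
    using fin by simp
  define Fs where "Fs = map ?f [0..<?L]"
  have enc: "c = ?f k \<longleftrightarrow> set_decode c = insert v (cyclic_pair us k)" for c k
    by (metis dec set_decode_inverse)
  have "c \<in> set Fs \<longleftrightarrow> c \<in> ?f ` {..<?L}" for c
    unfolding Fs_def by (simp add: atLeast0LessThan)
  then have "c \<in> set Fs \<longleftrightarrow> c \<in> set_decode -` {t \<in> T. v \<in> t}" for c
    unfolding star image_iff vimage_eq enc by blast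
  then have "set Fs = set_decode -` {t \<in> T. v \<in> t}"
    by blast
  then have "set Fs = faces_at ?X V"
    unfolding at .
  moreover have "distinct Fs"
    unfolding Fs_def distinct_map
  proof (intro conjI inj_onI)
    fix i j assume "i \<in> set [0..<?L]" "j \<in> set [0..<?L]" "?f i = ?f j"
    then show "i = j"
      using star_inj[OF us, of i j] dec by (metis atLeastLessThan_iff set_upt)
  qed simp
  moreover have "\<exists>e\<in>edges ?X. (V, e) \<in> inc ?X \<and> (e, Fs ! i) \<in> inc ?X \<and>
      (e, Fs ! (Suc i mod length Fs)) \<in> inc ?X" if "i < length Fs" for i
  proof -
    let ?s = "Suc i mod ?L"
    have i: "i < ?L" "?s < ?L"
      using that *(2) unfolding Fs_def by (auto intro!: mod_less_divisor)
    let ?w = "us ! ?s"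
    have w: "?w \<noteq> v"
      using *(3) i by (metis nth_mem)
    have nth: "Fs ! i = ?f i" "Fs ! (Suc i mod length Fs) = ?f ?s"
      using i unfolding Fs_def by auto
    have T: "insert v (cyclic_pair us i) \<in> T" "insert v (cyclic_pair us ?s) \<in> T"
      using star i by auto
    define e where "e = set_encode {v, ?w}"
    have e_dec: "set_decode e = {v, ?w}"
      unfolding e_def by (rule set_encode_inverse) simp
    have card_e: "card {v, ?w} = 2"
      using w by simp
    have in_both: "{v, ?w} \<subseteq> insert v (cyclic_pair us i)" "{v, ?w} \<subseteq> insert v (cyclic_pair us ?s)"
      unfolding cyclic_pair_def by auto
    then have "{v, ?w} \<in> simplices T 2"
      using T(1) card_e unfolding simplices_def by blast
    then have e: "e \<in> edges ?X"
      unfolding surface_of_sel vimage_eq e_dec .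
    have f: "?f i \<in> faces ?X" "?f ?s \<in> faces ?X"
      using T unfolding surface_of_sel vimage_eq dec .
    have "{v, ?w} \<noteq> insert v (cyclic_pair us i)" "{v, ?w} \<noteq> insert v (cyclic_pair us ?s)"
      using card_triangle[OF T(1)] card_triangle[OF T(2)] card_e by auto
    then have "{v, ?w} \<subset> insert v (cyclic_pair us i)" "{v, ?w} \<subset> insert v (cyclic_pair us ?s)"
      using in_both by blast+
    then have 2: "(e, ?f i) \<in> inc ?X" "(e, ?f ?s) \<in> inc ?X"
      using inc_iff[OF cellI(3)[OF f(1)], of e] inc_iff[OF cellI(3)[OF f(2)], of e]
      unfolding dec e_dec by (auto simp only: insert_not_empty)
    have "{v} \<subset> {v, ?w}"
      using w by blast
    then have 1: "(V, e) \<in> inc ?X"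
      using inc_iff[OF cellI(2)[OF e]] v(1) e_dec by simp
    show ?thesis
      using e 1 2 unfolding nth by blast
  qed
  ultimately show "\<exists>Fs. distinct Fs \<and> set Fs = faces_at ?X V \<and>
        (\<forall>i < length Fs. \<exists>e \<in> edges ?X. (V, e) \<in> inc ?X \<and>
          (e, Fs ! i) \<in> inc ?X \<and> (e, Fs ! (Suc i mod length Fs)) \<in> inc ?X)"
    by blast
qed

end

section \<open>Automorphisms as vertex maps\<close>

context simplicial_surface
begin

lemma boundary_eq: "boundary X F = {A. (A, F) \<in> inc X}"
  using inc_subset unfolding boundary_def by blast

lemma inc_cells: "(A, B) \<in> inc X \<Longrightarrow> A \<in> cells X \<and> B \<in> cells X"
  using inc_subset unfolding cells_def by blast

text \<open>
  The boundary of a face is the set of all cells below it, so a bijection that preserves and reflects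
  incidence restricts to isomorphisms of boundaries.
\<close>

lemma order_bijection_in_surface_hom:
  assumes bij: "bij_betw f (cells X) (cells X)"
    and inc: "\<And>A B. A \<in> cells X \<Longrightarrow> B \<in> cells X \<Longrightarrow> (A, B) \<in> inc X \<longleftrightarrow> (f A, f B) \<in> inc X"
  shows "f \<in> surface_hom X X"
proof -
  have "bij_betw f (boundary X F) (boundary X (f F))" if F: "F \<in> faces X" for F
    unfolding bij_betw_def boundary_eq
  proof (intro conjI subset_antisym subsetI)
    show "inj_on f {A. (A, F) \<in> inc X}"
      using bij inc_cells unfolding bij_betw_def by (auto intro: inj_on_subset)
  next
    fix B assume "B \<in> f ` {A. (A, F) \<in> inc X}"
    then show "B \<in> {A. (A, f F) \<in> inc X}"
      using inc inc_cells by blast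
  next
    fix B assume "B \<in> {A. (A, f F) \<in> inc X}"
    moreover from this obtain A where "A \<in> cells X" "B = f A"
      using bij inc_cells unfolding bij_betw_def by blast
    moreover have "F \<in> cells X"
      using F unfolding cells_def by blast
    ultimately show "B \<in> f ` {A. (A, F) \<in> inc X}"
      using inc by blast
  qed
  moreover have "f \<in> cells X \<rightarrow> cells X"
    using bij by (rule bij_betw_imp_funcset)
  moreover have "boundary X F \<subseteq> cells X" for F
    unfolding boundary_eq using inc_cells by blast
  ultimately show ?thesis
    unfolding surface_hom_def using inc by blast
qed

text \<open>
  The conditions on boundaries thereby disappear, and automorphisms become automorphisms of the
  incidence relation.
\<close>

lemma carrier_Aut:
  "carrier (Aut X) = {\<pi> \<in> Bij (cells X).
     \<forall>A \<in> cells X. \<forall>B \<in> cells X. (A, B) \<in> inc X \<longleftrightarrow> (\<pi> A, \<pi> B) \<in> inc X}"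
proof -
  have "\<pi> \<in> surface_hom X X \<and> inv_into (cells X) \<pi> \<in> surface_hom X X \<longleftrightarrow>
      (\<forall>A \<in> cells X. \<forall>B \<in> cells X. (A, B) \<in> inc X \<longleftrightarrow> (\<pi> A, \<pi> B) \<in> inc X)" (is "?L \<longleftrightarrow> ?R")
    if "\<pi> \<in> Bij (cells X)" for \<pi>
  proof
    have bij: "bij_betw \<pi> (cells X) (cells X)"
      using that unfolding Bij_def by blast
    let ?i = "inv_into (cells X) \<pi>"
    have i: "bij_betw ?i (cells X) (cells X)" "\<And>A. A \<in> cells X \<Longrightarrow> ?i (\<pi> A) = A"
      "\<And>A. A \<in> cells X \<Longrightarrow> \<pi> (?i A) = A" "\<And>A. A \<in> cells X \<Longrightarrow> ?i A \<in> cells X"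
      "\<And>A. A \<in> cells X \<Longrightarrow> \<pi> A \<in> cells X"
      using bij bij_betw_inv_into bij_betw_inv_into_left bij_betw_inv_into_right bij_betwE by metis+
    show ?R if ?L
    proof (intro ballI iffI)
      fix A B assume AB: "A \<in> cells X" "B \<in> cells X"
      show "(\<pi> A, \<pi> B) \<in> inc X" if "(A, B) \<in> inc X"
        using that \<open>?L\<close> AB unfolding surface_hom_def by blast
      show "(A, B) \<in> inc X" if "(\<pi> A, \<pi> B) \<in> inc X"
      proof -
        have "(?i (\<pi> A), ?i (\<pi> B)) \<in> inc X"
          using that \<open>?L\<close> i(5)[OF AB(1)] i(5)[OF AB(2)] unfolding surface_hom_def by blast
        then show ?thesis
          using i AB by simp
      qed
    qed
    show ?L if ?R
    proof
      show "\<pi> \<in> surface_hom X X"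
        using order_bijection_in_surface_hom[OF bij] that by blast
      have "(A, B) \<in> inc X \<longleftrightarrow> (?i A, ?i B) \<in> inc X" if "A \<in> cells X" "B \<in> cells X" for A B
        using \<open>?R\<close> i(3,4) that by metis
      then show "?i \<in> surface_hom X X"
        using order_bijection_in_surface_hom[OF i(1)] by blast
    qed
  qed
  then show ?thesis
    unfolding Aut_def by auto
qed

lemma vertex_in_flag:
  assumes "V \<in> verts X"
  obtains e F where "(V, e) \<in> inc X" "(e, F) \<in> inc X" "e \<in> edges X" "F \<in> faces X"
proof -
  have "faces_at X V \<noteq> {}"
    using degree_ge_3[OF assms] by fastforce
  then obtain F where F: "F \<in> faces X" "(V, F) \<in> inc X"
    unfolding faces_at_def by blast
  then have "{e \<in> edges X. (e, F) \<in> inc X \<and> (V, e) \<in> inc X} \<noteq> {}"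
    using face_corner[OF F(1) assms F(2)] by (metis card.empty zero_neq_numeral)
  then show thesis
    using that F(1) by blast
qed

lemma edge_has_vertex: "e \<in> edges X \<Longrightarrow> \<exists>V \<in> verts X. (V, e) \<in> inc X"
  using edge_verts by (metis (mono_tags, lifting) card.empty empty_Collect_eq zero_neq_numeral)

lemma edge_has_face: "e \<in> edges X \<Longrightarrow> \<exists>F \<in> faces X. (e, F) \<in> inc X"
  using edge_faces by (metis (mono_tags, lifting) card.empty empty_Collect_eq zero_neq_numeral)

lemma face_has_edge: "F \<in> faces X \<Longrightarrow> \<exists>e \<in> edges X. (e, F) \<in> inc X"
  using face_edges by (metis (mono_tags, lifting) card.empty empty_Collect_eq zero_neq_numeral)

text \<open>
  A chain of two incidences must run from a vertex through an edge to a face. Since every cell lies in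
  such a chain, the ranks are determined by incidence alone.
\<close>

lemma flag_ranks:
  assumes "(V, e) \<in> inc X" "(e, F) \<in> inc X"
  shows "V \<in> verts X" "e \<in> edges X" "F \<in> faces X"
proof -
  have "V \<in> verts X \<and> e \<in> edges X \<or> V \<in> edges X \<and> e \<in> faces X \<or> V \<in> verts X \<and> e \<in> faces X"
    using assms(1) inc_subset by blast
  moreover have "e \<in> verts X \<and> F \<in> edges X \<or> e \<in> edges X \<and> F \<in> faces X \<or> e \<in> verts X \<and> F \<in> faces X"
    using assms(2) inc_subset by blast
  ultimately show "V \<in> verts X" "e \<in> edges X" "F \<in> faces X"
    using disjoint by auto
qed

lemma Aut_preserves_rank:
  assumes "\<pi> \<in> carrier (Aut X)"
  shows "V \<in> verts X \<Longrightarrow> \<pi> V \<in> verts X"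
    and "e \<in> edges X \<Longrightarrow> \<pi> e \<in> edges X"
    and "F \<in> faces X \<Longrightarrow> \<pi> F \<in> faces X"
proof -
  have inc: "(\<pi> A, \<pi> B) \<in> inc X" if "(A, B) \<in> inc X" for A B
    using that assms inc_cells[OF that] unfolding carrier_Aut by blast
  show "\<pi> V \<in> verts X" if "V \<in> verts X" for V
    using vertex_in_flag[OF that] flag_ranks(1) inc by metis
  show "\<pi> e \<in> edges X" if "e \<in> edges X" for e
    using edge_has_vertex[OF that] edge_has_face[OF that] flag_ranks(2) inc by metis
  show "\<pi> F \<in> faces X" if "F \<in> faces X" for F
    using face_has_edge[OF that] edge_has_vertex flag_ranks(3) inc by metis
qed

end

text \<open>
  Expanding codes into sums of powers of two would prevent \<open>set_encode_inverse\<close> from applying.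
\<close>

declare set_encode_insert [simp del]

context triangulated_surface
begin

text \<open>
  The restriction to the cells makes the map extensional, as the elements of \<open>Bij\<close> have to be.
\<close>

definition induced :: "(nat \<Rightarrow> nat) \<Rightarrow> nat \<Rightarrow> nat" where
  "induced f = (\<lambda>c \<in> cells (surface_of T). set_encode (f ` set_decode c))"

lemma finite_vertices: "finite (\<Union>T)"
  using finite_T finite_triangle by blast

lemma cell_subset: "c \<in> cells (surface_of T) \<Longrightarrow> set_decode c \<subseteq> \<Union>T"
  unfolding in_cells_iff by blast

lemma finite_cells: "finite (cells (surface_of T))"
proof (rule finite_subset)
  show "cells (surface_of T) \<subseteq> set_decode -` Pow (\<Union>T)"
    using cell_subset by blast
  have "inj set_decode"
    by (metis injI set_decode_inverse)
  then show "finite (set_decode -` Pow (\<Union>T))"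
    using finite_vertices by (intro finite_vimageI) auto
qed

lemma decode_induced:
  "c \<in> cells (surface_of T) \<Longrightarrow> set_decode (induced f c) = f ` set_decode c"
  unfolding induced_def by simp

lemma induced_in_cells:
  assumes "\<And>t. t \<in> T \<Longrightarrow> f ` t \<in> T" "c \<in> cells (surface_of T)"
  shows "induced f c \<in> cells (surface_of T)"
  using assms(2) decode_induced[OF assms(2), of f] assms(1) unfolding in_cells_iff
  by (metis image_is_empty image_mono)

text \<open>
  Bijectivity on cells needs only injectivity, because there are finitely many cells.
\<close>

lemma induced_in_Aut:
  assumes inj: "inj_on f (\<Union>T)" and T: "\<And>t. t \<in> T \<Longrightarrow> f ` t \<in> T"
  shows "induced f \<in> carrier (Aut (surface_of T))"
proof -
  let ?X = "surface_of T"
  interpret X: simplicial_surface ?X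
    by (rule simplicial_surface)
  have eq: "f ` set_decode a = f ` set_decode b \<longleftrightarrow> set_decode a = set_decode b"
    and sub: "f ` set_decode a \<subseteq> f ` set_decode b \<longleftrightarrow> set_decode a \<subseteq> set_decode b"
    if "a \<in> cells ?X" "b \<in> cells ?X" for a b
    using that inj cell_subset by (auto simp: inj_on_image_eq_iff inj_on_image_subset_iff)
  have "inj_on (induced f) (cells ?X)"
    using eq decode_induced by (intro inj_onI) (metis set_decode_inverse)
  moreover have "induced f ` cells ?X \<subseteq> cells ?X"
    using induced_in_cells T by blast
  ultimately have "bij_betw (induced f) (cells ?X) (cells ?X)"
    using finite_cells endo_inj_surj unfolding bij_betw_def by blast
  then have "induced f \<in> Bij (cells ?X)"
    unfolding Bij_def by (auto simp: induced_def)
  moreover have "(a, b) \<in> inc ?X \<longleftrightarrow> (induced f a, induced f b) \<in> inc ?X"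
    if "a \<in> cells ?X" "b \<in> cells ?X" for a b
    using that eq sub decode_induced induced_in_cells T unfolding surface_of_sel psubset_eq by auto
  ultimately show ?thesis
    unfolding X.carrier_Aut by blast
qed

lemma card_decode:
  "c \<in> verts (surface_of T) \<Longrightarrow> card (set_decode c) = 1"
  "c \<in> edges (surface_of T) \<Longrightarrow> card (set_decode c) = 2"
  "c \<in> faces (surface_of T) \<Longrightarrow> card (set_decode c) = 3"
  unfolding surface_of_sel simplices_def using card_triangle by auto

text \<open>
  An automorphism maps vertices to vertices and thus yields a vertex map \<open>f\<close>. For a cell \<open>c\<close> all the
  vertices in \<open>f ` c\<close> lie in the image of \<open>c\<close>, which has the same number of vertices as \<open>c\<close> because ranks
  are preserved; so the two sets coincide.
\<close>

lemma Aut_is_induced: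
  assumes \<pi>: "\<pi> \<in> carrier (Aut (surface_of T))"
  obtains f where "inj_on f (\<Union>T)" "\<And>t. t \<in> T \<Longrightarrow> f ` t \<in> T" "\<pi> = induced f"
proof -
  let ?X = "surface_of T"
  interpret X: simplicial_surface ?X
    by (rule simplicial_surface)
  have bij: "bij_betw \<pi> (cells ?X) (cells ?X)" and ext: "\<pi> \<in> extensional (cells ?X)"
    using \<pi> unfolding X.carrier_Aut Bij_def by auto
  define f where "f v = the_elem (set_decode (\<pi> (set_encode {v})))" for v
  have vert: "set_encode {v} \<in> verts ?X" if "v \<in> \<Union>T" for v
    unfolding surface_of_sel simplices_1 vimage_eq using that by (subst set_encode_inverse) auto
  have f: "set_decode (\<pi> (set_encode {v})) = {f v}" if vT: "v \<in> \<Union>T" for v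
  proof -
    obtain u where "set_decode (\<pi> (set_encode {v})) = {u}"
      using X.Aut_preserves_rank(1)[OF \<pi> vert[OF vT]]
      unfolding surface_of_sel simplices_1 vimage_eq by blast
    then show ?thesis
      unfolding f_def by (simp only: the_elem_eq)
  qed
  have inj: "inj_on f (\<Union>T)"
  proof (rule inj_onI)
    fix v w assume vw: "v \<in> \<Union>T" "w \<in> \<Union>T" "f v = f w"
    then have "\<pi> (set_encode {v}) = \<pi> (set_encode {w})"
      using f by (metis set_decode_inverse)
    moreover have "set_encode {v} \<in> cells ?X" "set_encode {w} \<in> cells ?X"
      using vert vw unfolding cells_def by blast+
    ultimately have "set_encode {v} = set_encode {w}"
      using bij unfolding bij_betw_def by (meson inj_onD)
    then show "v = w"
      by (metis finite.emptyI finite.insertI set_encode_inverse singleton_inject)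
  qed
  have image: "f ` set_decode c = set_decode (\<pi> c)" if c: "c \<in> cells ?X" for c
  proof (rule card_subset_eq)
    show "finite (set_decode (\<pi> c))" by simp
    show "f ` set_decode c \<subseteq> set_decode (\<pi> c)"
    proof
      fix w assume "w \<in> f ` set_decode c"
      then obtain v where v: "v \<in> set_decode c" "w = f v"
        by blast
      then have vT: "v \<in> \<Union>T"
        using cell_subset c by blast
      have v_cell: "set_encode {v} \<in> cells ?X"
        using vert[OF vT] unfolding cells_def by blast
      have "{f v} \<subseteq> set_decode (\<pi> c)"
      proof (cases "set_decode c = {v}")
        case True
        then show ?thesis
          using f[OF vT] by (metis set_decode_inverse subset_refl)
      next
        case False
        then have "(set_encode {v}, c) \<in> inc ?X"
          using v(1) unfolding inc_iff[OF c] by auto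
        then have "(\<pi> (set_encode {v}), \<pi> c) \<in> inc ?X"
          using \<pi> c v_cell unfolding X.carrier_Aut by blast
        then show ?thesis
          unfolding surface_of_sel f[OF vT] by blast
      qed
      then show "w \<in> set_decode (\<pi> c)"
        using v(2) by blast
    qed
    have "card (f ` set_decode c) = card (set_decode c)"
      using inj cell_subset[OF c] by (intro card_image) (rule inj_on_subset)
    also have "\<dots> = card (set_decode (\<pi> c))"
      using c X.Aut_preserves_rank[OF \<pi>, of c] card_decode unfolding cells_def by (metis UnE)
    finally show "card (f ` set_decode c) = card (set_decode (\<pi> c))" .
  qed
  have "f ` t \<in> T" if "t \<in> T" for t
  proof -
    have t: "set_decode (set_encode t) = t"
      using that finite_triangle by simp
    then have "set_encode t \<in> faces ?X"
      using that unfolding surface_of_sel by simp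
    then show ?thesis
      using X.Aut_preserves_rank(3)[OF \<pi>, of "set_encode t"] image[of "set_encode t"] t
      unfolding surface_of_sel cells_def by simp
  qed
  moreover have "\<pi> = induced f"
  proof (rule extensionalityI[OF ext])
    show "induced f \<in> extensional (cells ?X)"
      unfolding induced_def by simp
    show "\<pi> c = induced f c" if "c \<in> cells ?X" for c
      using image[OF that] that unfolding induced_def by simp
  qed
  ultimately show thesis
    using inj that by blast
qed

lemma induced_eq_iff:
  "induced f = induced g \<longleftrightarrow> (\<forall>v \<in> \<Union>T. f v = g v)"
proof
  assume eq: "induced f = induced g"
  show "\<forall>v \<in> \<Union>T. f v = g v"
  proof
    fix v assume "v \<in> \<Union>T"
    then have "set_encode {v} \<in> cells (surface_of T)"
      unfolding in_cells_iff by (subst (1 2) set_encode_inverse) auto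
    then have "f ` {v} = g ` {v}"
      using eq decode_induced by (metis finite.emptyI finite.insertI set_encode_inverse)
    then show "f v = g v"
      by simp
  qed
next
  assume "\<forall>v \<in> \<Union>T. f v = g v"
  then have "f ` set_decode c = g ` set_decode c" if "c \<in> cells (surface_of T)" for c
    using cell_subset[OF that] by (intro image_cong) auto
  then show "induced f = induced g"
    unfolding induced_def by (intro restrict_ext) simp
qed

text \<open>
  This reduces the computation of the automorphism group to vertex maps: it suffices to have a
  faithful simplicial action among whose maps every injective simplicial map occurs.
\<close>

theorem Aut_iso_of_full_action:
  fixes G (structure) and \<rho> :: "'g \<Rightarrow> nat \<Rightarrow> nat"
  assumes "group G"
    and one: "\<And>v. v \<in> \<Union>T \<Longrightarrow> \<rho> \<one> v = v"
    and mult: "\<And>x y v. x \<in> carrier G \<Longrightarrow> y \<in> carrier G \<Longrightarrow> v \<in> \<Union>T \<Longrightarrow> \<rho> (x \<otimes> y) v = \<rho> x (\<rho> y v)"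
    and simplicial: "\<And>x t. x \<in> carrier G \<Longrightarrow> t \<in> T \<Longrightarrow> \<rho> x ` t \<in> T"
    and faithful: "\<And>x y. x \<in> carrier G \<Longrightarrow> y \<in> carrier G \<Longrightarrow> \<forall>v \<in> \<Union>T. \<rho> x v = \<rho> y v \<Longrightarrow> x = y"
    and full: "\<And>f. inj_on f (\<Union>T) \<Longrightarrow> (\<And>t. t \<in> T \<Longrightarrow> f ` t \<in> T) \<Longrightarrow>
      \<exists>x \<in> carrier G. \<forall>v \<in> \<Union>T. f v = \<rho> x v"
  shows "G \<cong> Aut (surface_of T)"
proof -
  let ?X = "surface_of T"
  interpret group G by fact
  have inj: "inj_on (\<rho> x) (\<Union>T)" if "x \<in> carrier G" for x
  proof (rule inj_on_inverseI)
    fix v assume "v \<in> \<Union>T"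
    then show "\<rho> (inv x) (\<rho> x v) = v"
      using mult[OF inv_closed[OF that] that] one l_inv[OF that] by metis
  qed
  have in_Aut: "induced (\<rho> x) \<in> carrier (Aut ?X)" if "x \<in> carrier G" for x
    using inj[OF that] simplicial[OF that] by (rule induced_in_Aut)
  have "induced (\<rho> (x \<otimes> y)) = induced (\<rho> x) \<otimes>\<^bsub>Aut ?X\<^esub> induced (\<rho> y)"
    if xy: "x \<in> carrier G" "y \<in> carrier G" for x y
  proof -
    have "induced (\<rho> (x \<otimes> y)) = compose (cells ?X) (induced (\<rho> x)) (induced (\<rho> y))"
    proof (rule extensionalityI)
      show "induced (\<rho> (x \<otimes> y)) c = compose (cells ?X) (induced (\<rho> x)) (induced (\<rho> y)) c"
        if c: "c \<in> cells ?X" for c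
      proof -
        have "\<rho> (x \<otimes> y) ` set_decode c = \<rho> x ` \<rho> y ` set_decode c"
          unfolding image_image using mult[OF xy] cell_subset[OF c] by (intro image_cong) blast+
        then have "set_decode (induced (\<rho> (x \<otimes> y)) c) = set_decode (induced (\<rho> x) (induced (\<rho> y) c))"
          using c decode_induced induced_in_cells[OF simplicial[OF xy(2)]] by simp
        then show ?thesis
          using c unfolding compose_def by (metis restrict_apply' set_decode_inverse)
      qed
    qed (auto simp: induced_def)
    moreover have "carrier (Aut ?X) \<subseteq> Bij (cells ?X)"
      unfolding Aut_def by auto
    ultimately show ?thesis
      using in_Aut xy unfolding Aut_def by (auto simp: BijGroup_def)
  qed
  then have "(\<lambda>x. induced (\<rho> x)) \<in> hom G (Aut ?X)"
    using in_Aut by (intro homI)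
  moreover have "inj_on (\<lambda>x. induced (\<rho> x)) (carrier G)"
    using faithful unfolding inj_on_def induced_eq_iff by blast
  moreover have "\<pi> \<in> (\<lambda>x. induced (\<rho> x)) ` carrier G" if \<pi>: "\<pi> \<in> carrier (Aut ?X)" for \<pi>
  proof -
    obtain f where "inj_on f (\<Union>T)" "\<And>t. t \<in> T \<Longrightarrow> f ` t \<in> T" "\<pi> = induced f"
      using Aut_is_induced[OF \<pi>] by metis
    then show ?thesis
      using full[of f] induced_eq_iff by blast
  qed
  ultimately show ?thesis
    using in_Aut unfolding is_iso_def iso_def bij_betw_def by blast
qed

end

section \<open>Embeddings from vertex colourings\<close>

text \<open>
  Four alternating corners of a cube whose faces have diagonals of length one.
\<close>

definition tetrahedron :: "nat \<Rightarrow> real ^ 3" where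
  "tetrahedron i = (1 / sqrt 2) *\<^sub>R (if i = 0 then vector [0, 0, 0] else if i = 1 then vector [1, 1, 0]
     else if i = 2 then vector [1, 0, 1] else vector [0, 1, 1])"

lemma tetrahedron_equilateral:
  assumes "i < 4" "j < 4" "i \<noteq> j"
  shows "(norm (tetrahedron i - tetrahedron j))\<^sup>2 = 1"
proof -
  have "i \<in> {0,1,2,3}" "j \<in> {0,1,2,3}"
    using assms by auto
  then show ?thesis
    using assms(3) unfolding tetrahedron_def
    by (auto simp: power2_norm_eq_inner inner_vec_def sum_3 power2_eq_square[symmetric] power_divide)
qed

text \<open>
  Adjacent vertices lie in a common triangle and have different colours, hence go to different corners
  of the tetrahedron.
\<close>

lemma (in triangulated_surface) four_colouring_embedding:
  fixes col :: "nat \<Rightarrow> nat"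
  assumes "\<And>v. v \<in> \<Union>T \<Longrightarrow> col v < 4" and proper: "\<And>t. t \<in> T \<Longrightarrow> inj_on col t"
  shows "\<exists>\<phi>. equilateral_embedding (surface_of T) \<phi>"
proof (intro exI)
  let ?X = "surface_of T"
  let ?\<phi> = "\<lambda>c. tetrahedron (col (the_elem (set_decode c)))"
  show "equilateral_embedding ?X ?\<phi>"
    unfolding equilateral_embedding_def
  proof (intro ballI impI)
    fix e V W
    assume e: "e \<in> edges ?X" and V: "V \<in> verts ?X" and W: "W \<in> verts ?X"
      and VW: "V \<noteq> W \<and> (V, e) \<in> inc ?X \<and> (W, e) \<in> inc ?X"
    obtain v w where v: "set_decode V = {v}" "set_decode W = {w}" "v \<in> \<Union>T" "w \<in> \<Union>T"
      using V W unfolding surface_of_sel simplices_1 by auto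
    obtain t where "t \<in> T" "set_decode e \<subseteq> t"
      using e unfolding surface_of_sel simplices_def by auto
    moreover have "v \<in> set_decode e" "w \<in> set_decode e"
      using VW v unfolding surface_of_sel by auto
    moreover have "v \<noteq> w"
      using VW v by (metis set_decode_inverse)
    ultimately have "col v \<noteq> col w"
      using proper by (meson inj_onD subsetD)
    then show "(norm (?\<phi> V - ?\<phi> W))\<^sup>2 = 1"
      using tetrahedron_equilateral assms(1) v by simp
  qed
qed

section \<open>A cone over a triangulated polygon\<close>

text \<open>
  The parameter \<open>m\<close> is the number of rim vertices per sector and \<open>n\<close> the number of sectors. The integers
  are used throughout, so that rim indices can be shifted freely.
\<close>

locale decorated_cone =
  fixes m n :: int
  assumes mn: "m = 2 \<and> 4 \<le> n \<or> m = 3 \<and> 3 \<le> n"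
begin

text \<open>
  The rim occupies the naturals below \<open>m n\<close>; indexing it by all integers modulo \<open>m n\<close> turns rotations into
  additions. The corners are the vertices \<open>rim (m * i)\<close>.
\<close>

definition rim :: "int \<Rightarrow> nat" where
  "rim k = nat (k mod (m * n))"

definition apex :: nat where
  "apex = nat (m * n)"

text \<open>
  The vertex \<open>S\<close> of the introduction.
\<close>

definition nadir :: nat where
  "nadir = Suc apex"

text \<open>
  The \<open>j\<close>-th triangle of the \<open>i\<close>-th sector; the sector is triangulated by the diagonals from its first
  corner.
\<close>

definition fan :: "int \<Rightarrow> int \<Rightarrow> nat set" where
  "fan i j = {rim (m * i), rim (m * i + j), rim (m * i + j + 1)}"

definition triangles :: "nat set set" where
  "triangles = {{apex, rim k, rim (k + 1)} | k. True} \<union>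
     {{nadir, rim (m * i), rim (m * i + m)} | i. True} \<union>
     {fan i j | i j. 0 < j \<and> j < m}"

lemma m_pos: "2 \<le> m" "m \<le> 3" "3 \<le> n" "8 \<le> m * n"
  using mn by auto

lemma rim_eq_iff: "rim k = rim l \<longleftrightarrow> k mod (m * n) = l mod (m * n)"
proof -
  have "0 \<le> k mod (m * n)" "0 \<le> l mod (m * n)"
    using m_pos by auto
  then show ?thesis
    unfolding rim_def by (metis nat_eq_iff2 eq_nat_nat_iff)
qed

lemma rim_shift: "rim k = rim l \<Longrightarrow> rim (k + d) = rim (l + d)"
  unfolding rim_eq_iff by (rule mod_add_cong) auto

lemma rim_shift': "rim k = rim l \<Longrightarrow> rim (k - d) = rim (l - d)"
  unfolding rim_eq_iff by (rule mod_diff_cong) auto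

lemma int_rim: "int (rim k) = k mod (m * n)"
  unfolding rim_def using m_pos by simp

lemma rim_less_apex: "rim k < apex"
  unfolding rim_def apex_def using m_pos by simp

lemma vertex_neq [simp]:
  "rim k \<noteq> apex" "apex \<noteq> rim k" "rim k \<noteq> nadir" "nadir \<noteq> rim k" "apex \<noteq> nadir" "nadir \<noteq> apex"
  using rim_less_apex[of k] unfolding nadir_def by auto

text \<open>
  The rim has at least eight vertices. The links of rim vertices only involve indices that differ by at
  most six, so their vertices are distinct.
\<close>

lemma rim_neq:
  assumes "k < l" "l < k + 8"
  shows "rim k \<noteq> rim l" "rim l \<noteq> rim k"
proof -
  have "rim k \<noteq> rim l"
  proof
    assume "rim k = rim l"
    then have "m * n dvd l - k"
      unfolding rim_eq_iff by (metis mod_eq_dvd_iff)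
    then have "m * n \<le> l - k"
      using assms(1) by (intro zdvd_imp_le) auto
    then show False
      using assms(2) m_pos by simp
  qed
  then show "rim k \<noteq> rim l" "rim l \<noteq> rim k"
    by auto
qed

text \<open>
  As \<open>m\<close> divides the length of the rim, the position within a sector is well defined. The second part
  says that the sector itself is then determined up to the period.
\<close>

lemma rim_sector:
  assumes "rim (m * i + j) = rim (m * i' + j')" "0 \<le> j" "j < m" "0 \<le> j'" "j' < m"
  shows "j = j'" and "rim (m * i + d) = rim (m * i' + d)"
proof -
  have "(m * i + j) mod m = (m * i' + j') mod m"
    using assms(1) unfolding rim_eq_iff by (metis mod_mod_cancel dvd_triv_left)
  then show "j = j'"
    using assms by simp
  then show "rim (m * i + d) = rim (m * i' + d)"
    using rim_shift[OF assms(1), of "d - j"] by simp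
qed

lemma apex_star: "{t \<in> triangles. apex \<in> t} = {{apex, rim k, rim (k + 1)} | k. True}"
  unfolding triangles_def fan_def by auto

lemma nadir_star: "{t \<in> triangles. nadir \<in> t} = {{nadir, rim (m * i), rim (m * i + m)} | i. True}"
  unfolding triangles_def fan_def by auto

text \<open>
  The stars of rim vertices are collected family by family. Each family is parametrised by all integers;
  a triangle of the family that contains the given vertex can be reparametrised by shifting its index,
  since equality of rim vertices is stable under shifts.
\<close>

lemma apex_star_rim:
  "{{apex, rim l, rim (l + 1)} | l. rim k \<in> {apex, rim l, rim (l + 1)}} =
   {{apex, rim k, rim (k + 1)}, {apex, rim (k - 1), rim k}}"
proof (intro subset_antisym subsetI)
  fix t assume "t \<in> {{apex, rim l, rim (l + 1)} | l. rim k \<in> {apex, rim l, rim (l + 1)}}"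
  then obtain l where t: "t = {apex, rim l, rim (l + 1)}" and "rim k = rim l \<or> rim k = rim (l + 1)"
    by auto
  then consider "rim l = rim k" "rim (l + 1) = rim (k + 1)" | "rim l = rim (k - 1)" "rim (l + 1) = rim k"
    using rim_shift[of k l 1] rim_shift'[of k "l + 1" 1] by force
  then show "t \<in> {{apex, rim k, rim (k + 1)}, {apex, rim (k - 1), rim k}}"
    by cases (auto simp: t)
next
  fix t assume "t \<in> {{apex, rim k, rim (k + 1)}, {apex, rim (k - 1), rim k}}"
  then consider "t = {apex, rim k, rim (k + 1)}" | "t = {apex, rim (k - 1), rim k}"
    by blast
  then show "t \<in> {{apex, rim l, rim (l + 1)} | l. rim k \<in> {apex, rim l, rim (l + 1)}}"
  proof cases
    case 1
    then show ?thesis by (intro CollectI exI[of _ k]) simp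
  next
    case 2
    then show ?thesis by (intro CollectI exI[of _ "k - 1"]) simp
  qed
qed

lemma nadir_star_corner:
  "{{nadir, rim (m * l), rim (m * l + m)} | l. rim (m * i) \<in> {nadir, rim (m * l), rim (m * l + m)}} =
   {{nadir, rim (m * i), rim (m * i + m)}, {nadir, rim (m * i - m), rim (m * i)}}"
proof (intro subset_antisym subsetI)
  fix t assume "t \<in> {{nadir, rim (m * l), rim (m * l + m)} | l. rim (m * i) \<in> {nadir, rim (m * l), rim (m * l + m)}}"
  then obtain l where t: "t = {nadir, rim (m * l), rim (m * l + m)}"
    and "rim (m * i) = rim (m * l) \<or> rim (m * i) = rim (m * l + m)"
    by auto
  then consider "rim (m * l) = rim (m * i)" "rim (m * l + m) = rim (m * i + m)"
    | "rim (m * l) = rim (m * i - m)" "rim (m * l + m) = rim (m * i)"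
    using rim_shift[of "m * i" "m * l" m] rim_shift'[of "m * i" "m * l + m" m] by force
  then show "t \<in> {{nadir, rim (m * i), rim (m * i + m)}, {nadir, rim (m * i - m), rim (m * i)}}"
    by cases (auto simp: t)
next
  fix t assume "t \<in> {{nadir, rim (m * i), rim (m * i + m)}, {nadir, rim (m * i - m), rim (m * i)}}"
  then consider "t = {nadir, rim (m * i), rim (m * i + m)}" | "t = {nadir, rim (m * i - m), rim (m * i)}"
    by blast
  then show "t \<in> {{nadir, rim (m * l), rim (m * l + m)} | l. rim (m * i) \<in> {nadir, rim (m * l), rim (m * l + m)}}"
  proof cases
    case 1
    then show ?thesis by (intro CollectI exI[of _ i]) simp
  next
    case 2
    then show ?thesis by (intro CollectI exI[of _ "i - 1"]) (simp add: algebra_simps)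
  qed
qed

lemma nadir_star_inner:
  assumes "0 < j" "j < m"
  shows "rim (m * i + j) \<notin> {nadir, rim (m * l), rim (m * l + m)}"
proof -
  have "rim (m * i + j) \<noteq> rim (m * l' + 0)" for l'
    using rim_sector(1)[of i j l' 0] assms by auto
  from this[of l] this[of "l + 1"] show ?thesis
    by (simp add: algebra_simps)
qed

text \<open>
  A corner belongs to all triangles of the sector it starts and to the last triangle of the sector it ends.
\<close>

lemma fan_star_corner:
  "{fan l j | l j. 0 < j \<and> j < m \<and> rim (m * i) \<in> fan l j} =
   {fan i j | j. 0 < j \<and> j < m} \<union> {fan (i - 1) (m - 1)}"
proof (intro subset_antisym subsetI)
  fix t assume "t \<in> {fan l j | l j. 0 < j \<and> j < m \<and> rim (m * i) \<in> fan l j}"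
  then obtain l j where t: "t = fan l j" and j: "0 < j" "j < m"
    and "rim (m * i) = rim (m * l) \<or> rim (m * i) = rim (m * l + j) \<or> rim (m * i) = rim (m * l + j + 1)"
    unfolding fan_def by auto
  moreover have "rim (m * i) \<noteq> rim (m * l + j)"
    using rim_sector(1)[of i 0 l j] j m_pos by fastforce
  moreover have "j = m - 1" if "rim (m * i) = rim (m * l + j + 1)"
  proof (rule ccontr)
    assume "j \<noteq> m - 1"
    then have "0 = j + 1"
      using rim_sector(1)[of i 0 l "j + 1"] j that by (simp add: add.assoc)
    then show False
      using j by simp
  qed
  ultimately consider "rim (m * i) = rim (m * l)" | "rim (m * i) = rim (m * l + m)" "j = m - 1"
    by fastforce
  then show "t \<in> {fan i j | j. 0 < j \<and> j < m} \<union> {fan (i - 1) (m - 1)}"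
  proof cases
    case 1
    then have "rim (m * l + d) = rim (m * i + d)" for d
      using rim_shift by metis
    then have "fan l j = fan i j"
      using 1 unfolding fan_def by (simp add: add.assoc)
    then show ?thesis
      using t j by blast
  next
    case 2
    have "rim (m * (i - 1) + d) = rim (m * l + d)" for d
      using rim_shift[OF 2(1), of "d - m"] by (simp add: algebra_simps)
    from this this[of 0] have "fan (i - 1) (m - 1) = fan l (m - 1)"
      unfolding fan_def by (simp add: add.assoc)
    then show ?thesis
      using t 2 by simp
  qed
next
  fix t assume "t \<in> {fan i j | j. 0 < j \<and> j < m} \<union> {fan (i - 1) (m - 1)}"
  moreover have "rim (m * i) \<in> fan i j" for j
    unfolding fan_def by simp
  moreover have "rim (m * i) \<in> fan (i - 1) (m - 1)"
    unfolding fan_def by (simp add: algebra_simps)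
  moreover have "0 < m - 1" "m - 1 < m"
    using m_pos by auto
  ultimately show "t \<in> {fan l j | l j. 0 < j \<and> j < m \<and> rim (m * i) \<in> fan l j}"
    by blast
qed

lemma fan_star_inner:
  assumes j: "0 < j" "j < m"
  shows "{fan l j' | l j'. 0 < j' \<and> j' < m \<and> rim (m * i + j) \<in> fan l j'} =
   {fan i j} \<union> (if j = 1 then {} else {fan i (j - 1)})"
proof (intro subset_antisym subsetI)
  fix t assume "t \<in> {fan l j' | l j'. 0 < j' \<and> j' < m \<and> rim (m * i + j) \<in> fan l j'}"
  then obtain l j' where t: "t = fan l j'" and j': "0 < j'" "j' < m"
    and *: "rim (m * i + j) = rim (m * l + 0) \<or> rim (m * i + j) = rim (m * l + j')
      \<or> rim (m * i + j) = rim (m * l + (j' + 1))"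
    unfolding fan_def by (auto simp: add.assoc)
  have "rim (m * i + j) \<noteq> rim (m * l' + 0)" for l'
    using rim_sector(1)[of i j l' 0] j by auto
  from this[of l] this[of "l + 1"] have "rim (m * i + j) \<noteq> rim (m * l + 0)" "rim (m * i + j) \<noteq> rim (m * l + m)"
    by (simp_all add: algebra_simps)
  then obtain e where e: "0 \<le> e" "e < m" "rim (m * i + j) = rim (m * l + e)" "e = j' \<or> e = j' + 1"
  proof (cases "rim (m * i + j) = rim (m * l + j')")
    case True
    then show thesis
      using that[of j'] j' by simp
  next
    case False
    then have eq: "rim (m * i + j) = rim (m * l + (j' + 1))"
      using * \<open>rim (m * i + j) \<noteq> rim (m * l + 0)\<close> by blast
    moreover from this have "j' + 1 \<noteq> m"
      using \<open>rim (m * i + j) \<noteq> rim (m * l + m)\<close> by metis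
    ultimately show thesis
      using that[of "j' + 1"] j' by simp
  qed
  have "e = j" and shift: "rim (m * l + d) = rim (m * i + d)" for d
    using rim_sector[OF e(3)] e j by auto
  from shift shift[of 0] have "fan l j' = fan i j'"
    unfolding fan_def by (simp add: add.assoc)
  moreover have "j' = j \<or> j' = j - 1 \<and> j \<noteq> 1"
    using e(4) \<open>e = j\<close> j' by auto
  ultimately show "t \<in> {fan i j} \<union> (if j = 1 then {} else {fan i (j - 1)})"
    unfolding t by auto
next
  fix t assume t: "t \<in> {fan i j} \<union> (if j = 1 then {} else {fan i (j - 1)})"
  have "rim (m * i + j) \<in> fan i j" "rim (m * i + j) \<in> fan i (j - 1)"
    unfolding fan_def by simp_all
  moreover have "0 < j - 1 \<and> j - 1 < m" if "j \<noteq> 1"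
    using j that by simp
  moreover have "t = fan i j \<or> j \<noteq> 1 \<and> t = fan i (j - 1)"
    using t by (simp split: if_splits)
  ultimately show "t \<in> {fan l j' | l j'. 0 < j' \<and> j' < m \<and> rim (m * i + j) \<in> fan l j'}"
    using j by blast
qed

lemma star_split:
  "{t \<in> triangles. v \<in> t} = {{apex, rim l, rim (l + 1)} | l. v \<in> {apex, rim l, rim (l + 1)}} \<union>
     {{nadir, rim (m * l), rim (m * l + m)} | l. v \<in> {nadir, rim (m * l), rim (m * l + m)}} \<union>
     {fan l j | l j. 0 < j \<and> j < m \<and> v \<in> fan l j}"
  unfolding triangles_def by blast

lemma star_corner:
  "{t \<in> triangles. rim (m * i) \<in> t} =
    {{apex, rim (m * i), rim (m * i + 1)}, {apex, rim (m * i - 1), rim (m * i)},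
     {nadir, rim (m * i), rim (m * i + m)}, {nadir, rim (m * i - m), rim (m * i)}, fan (i - 1) (m - 1)} \<union>
    {fan i j | j. 0 < j \<and> j < m}"
proof -
  have "{a, b} \<union> {c, d} \<union> (C \<union> {e}) = {a, b, c, d, e} \<union> C" for a b c d e :: "nat set" and C
    by blast
  then show ?thesis
    unfolding star_split apex_star_rim nadir_star_corner fan_star_corner .
qed

lemma star_inner:
  assumes "0 < j" "j < m"
  shows "{t \<in> triangles. rim (m * i + j) \<in> t} =
    {{apex, rim (m * i + j), rim (m * i + j + 1)}, {apex, rim (m * i + j - 1), rim (m * i + j)}, fan i j} \<union>
    (if j = 1 then {} else {fan i (j - 1)})"
proof -
  have no_nadir: "{{nadir, rim (m * l), rim (m * l + m)} | l.
      rim (m * i + j) \<in> {nadir, rim (m * l), rim (m * l + m)}} = {}"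
    using nadir_star_inner[OF assms] by blast
  have "{a, b} \<union> {} \<union> ({c} \<union> C) = {a, b, c} \<union> C" for a b c :: "nat set" and C
    by blast
  then show ?thesis
    unfolding star_split apex_star_rim no_nadir fan_star_inner[OF assms] .
qed

lemma link_apex: "link_cycle triangles apex (map (\<lambda>k. rim (int k)) [0..<nat (m * n)])"
  using apex_star m_pos by (intro link_cycle_periodic rim_eq_iff) auto

lemma link_nadir: "link_cycle triangles nadir (map (\<lambda>i. rim (m * int i)) [0..<nat n])"
proof (rule link_cycle_periodic)
  show "rim (m * a) = rim (m * b) \<longleftrightarrow> a mod n = b mod n" for a b
    unfolding rim_eq_iff mult_mod_right[symmetric] using m_pos by simp
  show "{t \<in> triangles. nadir \<in> t} = {{nadir, rim (m * i), rim (m * (i + 1))} | i. True}"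
    unfolding nadir_star by (simp add: algebra_simps)
qed (use m_pos in auto)

lemma fan_last: "fan (i - 1) (m - 1) = {rim (m * i - m), rim (m * i - 1), rim (m * i)}"
  unfolding fan_def by (simp add: algebra_simps)

text \<open>
  Bounding the lengths by eight is enough to tell the apex, of degree \<open>m n \<ge> 8\<close>, from all rim vertices.
\<close>

lemma link_corner:
  "\<exists>us. link_cycle triangles (rim (m * i)) us \<and> length us < 8"
proof -
  consider "m = 2" | "m = 3"
    using mn by auto
  then show ?thesis
  proof cases
    case 1
    have "{fan i j | j. 0 < j \<and> j < m} = {fan i j | j. j = 1}"
      using 1 by (intro Collect_cong ex_cong1) auto
    also have "\<dots> = {{rim (m * i), rim (m * i + 1), rim (m * i + m)}}"
      using 1 unfolding fan_def by (simp add: algebra_simps)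
    finally have fan: "{fan i j | j. 0 < j \<and> j < m} = {{rim (m * i), rim (m * i + 1), rim (m * i + m)}}" .
    let ?us = "[apex, rim (m * i + 1), rim (m * i + m), nadir, rim (m * i - m), rim (m * i - 1)]"
    have "link_cycle triangles (rim (m * i)) ?us"
      using m_pos(1,2) unfolding link_cycle_iff_zip star_corner fan fan_last
      by (simp add: rim_neq insert_commute)
    then show ?thesis
      by force
  next
    case 2
    have "{fan i j | j. 0 < j \<and> j < m} = {fan i j | j. j = 1 \<or> j = 2}"
      using 2 by (intro Collect_cong ex_cong1) auto
    also have "\<dots> = {fan i 1, fan i 2}"
      by blast
    also have "\<dots> = {{rim (m * i), rim (m * i + 1), rim (m * i + 2)},
        {rim (m * i), rim (m * i + 2), rim (m * i + m)}}"
      using 2 unfolding fan_def by (simp add: algebra_simps)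
    finally have fan: "{fan i j | j. 0 < j \<and> j < m} = {{rim (m * i), rim (m * i + 1), rim (m * i + 2)},
        {rim (m * i), rim (m * i + 2), rim (m * i + m)}}" .
    let ?us = "[apex, rim (m * i + 1), rim (m * i + 2), rim (m * i + m), nadir,
      rim (m * i - m), rim (m * i - 1)]"
    have "2 < m" "m < 4"
      using 2 by auto
    then have "link_cycle triangles (rim (m * i)) ?us"
      unfolding link_cycle_iff_zip star_corner fan fan_last
      by (simp add: rim_neq insert_commute)
    then show ?thesis
      by force
  qed
qed

lemma link_inner:
  assumes "0 < j" "j < m"
  shows "\<exists>us. link_cycle triangles (rim (m * i + j)) us \<and> length us < 8"
proof (cases "j = 1")
  case True
  have "link_cycle triangles (rim (m * i + 1)) [apex, rim (m * i + 2), rim (m * i)]"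
    unfolding link_cycle_iff_zip star_inner[OF assms, unfolded True] fan_def
    by (simp add: rim_neq insert_commute add.commute)
  then show ?thesis
    using True by force
next
  case False
  then have j: "j = 2" "m \<le> 3"
    using assms m_pos by auto
  have "link_cycle triangles (rim (m * i + 2)) [apex, rim (m * i + 3), rim (m * i), rim (m * i + 1)]"
    unfolding link_cycle_iff_zip star_inner[OF assms, unfolded j(1)] fan_def
    by (simp add: rim_neq insert_commute add.commute)
  then show ?thesis
    using j by force
qed

lemma rim_sector_cases:
  obtains i j where "0 \<le> j" "j < m" "k = m * i + j"
  using that[of "k mod m" "k div m"] m_pos by simp

lemma link_rim: "\<exists>us. link_cycle triangles (rim k) us \<and> length us < 8"
  using rim_sector_cases[of k] link_corner link_inner by (metis add.right_neutral order_le_less)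

lemma apex_triangle: "{apex, rim k, rim (k + 1)} \<in> triangles"
  unfolding triangles_def by blast

lemma nadir_triangle: "{nadir, rim (m * i), rim (m * i + m)} \<in> triangles"
  unfolding triangles_def by blast

lemma fan_triangle: "0 < j \<Longrightarrow> j < m \<Longrightarrow> fan i j \<in> triangles"
  unfolding triangles_def by blast

lemma triangle_cases [consumes 1, case_names apex nadir fan]:
  assumes "t \<in> triangles"
  obtains (apex) k where "t = {apex, rim k, rim (k + 1)}"
    | (nadir) i where "t = {nadir, rim (m * i), rim (m * i + m)}"
    | (fan) i j where "0 < j" "j < m" "t = fan i j"
  using assms unfolding triangles_def by blast

lemma vertices: "\<Union>triangles = range rim \<union> {apex, nadir}"
proof (intro subset_antisym subsetI)
  fix v assume "v \<in> \<Union>triangles"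
  then obtain t where "t \<in> triangles" "v \<in> t"
    by blast
  then show "v \<in> range rim \<union> {apex, nadir}"
    by (cases t rule: triangle_cases) (auto simp: fan_def)
next
  fix v assume "v \<in> range rim \<union> {apex, nadir}"
  then show "v \<in> \<Union>triangles"
    using apex_triangle nadir_triangle by blast
qed

sublocale triangulated_surface triangles
proof
  have "range rim \<subseteq> {..<apex}"
    using rim_less_apex by auto
  then have "finite (\<Union>triangles)"
    unfolding vertices using finite_subset by auto
  then show "finite triangles"
    by (rule finite_UnionD)
  show "triangles \<noteq> {}"
    using apex_triangle by blast
  show "{} \<notin> triangles"
    unfolding triangles_def fan_def by blast
  show "\<exists>us. link_cycle triangles v us" if "v \<in> \<Union>triangles" for v
    using that link_apex link_nadir link_rim unfolding vertices by blast
qed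

section \<open>Symmetries of the cone\<close>

text \<open>
  With \<open>\<epsilon> = 1\<close> this is the rotation by \<open>a\<close> sectors and with \<open>\<epsilon> = -1\<close> a reflection; apex and nadir, which
  are not below \<open>m n\<close>, are fixed.
\<close>

definition act :: "int \<Rightarrow> int \<Rightarrow> nat \<Rightarrow> nat" where
  "act a \<epsilon> v = (if v < apex then rim (m * a + \<epsilon> * int v) else v)"

lemma act_simps [simp]:
  "act a \<epsilon> (rim k) = rim (m * a + \<epsilon> * k)" "act a \<epsilon> apex = apex" "act a \<epsilon> nadir = nadir"
proof -
  have "(m * a + \<epsilon> * (k mod (m * n))) mod (m * n) = (m * a + \<epsilon> * k) mod (m * n)"
    by (metis mod_add_right_eq mod_mult_right_eq)
  then show "act a \<epsilon> (rim k) = rim (m * a + \<epsilon> * k)"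
    unfolding act_def using rim_less_apex by (simp add: rim_eq_iff int_rim)
qed (auto simp: act_def nadir_def)

lemma rotation_simplicial:
  assumes "t \<in> triangles"
  shows "act a 1 ` t \<in> triangles"
  using assms
proof (cases rule: triangle_cases)
  case (apex k)
  then show ?thesis
    using apex_triangle[of "m * a + k"] by (simp add: add.assoc)
next
  case (nadir i)
  then show ?thesis
    using nadir_triangle[of "a + i"] by (simp add: algebra_simps)
next
  case (fan i j)
  then show ?thesis
    using fan_triangle[of j "a + i"] by (simp add: fan_def algebra_simps)
qed

text \<open>
  A reflection sends the sector that starts at \<open>2 i\<close> to the one that starts at \<open>2 (a - i - 1)\<close>. For \<open>m = 2\<close> a
  sector is cut off by a single triangle, whose two corners are interchanged.
\<close>

lemma reflection_simplicial:
  assumes m: "m = 2" and "t \<in> triangles"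
  shows "act a (-1) ` t \<in> triangles"
  using assms(2)
proof (cases rule: triangle_cases)
  case (apex k)
  then show ?thesis
    using apex_triangle[of "m * a - k - 1"] by (simp add: insert_commute algebra_simps)
next
  case (nadir i)
  then show ?thesis
    using nadir_triangle[of "a - i - 1"] by (simp add: insert_commute algebra_simps)
next
  case (fan i j)
  have "j = 1"
    using fan m by simp
  have "act a (-1) ` t = {rim (m * a - m * i), rim (m * a - m * i - 1), rim (m * a - m * i - 2)}"
    unfolding fan(3) fan_def \<open>j = 1\<close> by (simp add: algebra_simps)
  also have "\<dots> = fan (a - i - 1) 1"
  proof -
    have "m * (a - i - 1) = m * a - m * i - 2"
      using m by (simp add: algebra_simps)
    then show ?thesis
      unfolding fan_def by (simp add: insert_commute)
  qed
  finally show ?thesis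
    using fan_triangle[of 1 "a - i - 1"] m by simp
qed

lemma act_mod: "act (a mod n) \<epsilon> v = act a \<epsilon> v"
proof -
  have "(m * (a mod n) + \<epsilon> * k) mod (m * n) = (m * a + \<epsilon> * k) mod (m * n)" for k
    unfolding mult_mod_right by (rule mod_add_left_eq)
  then have "rim (m * (a mod n) + \<epsilon> * k) = rim (m * a + \<epsilon> * k)" for k
    unfolding rim_eq_iff .
  then show ?thesis
    unfolding act_def by simp
qed

lemma act_act:
  assumes "v \<in> \<Union>triangles"
  shows "act a \<epsilon> (act b \<delta> v) = act (a + \<epsilon> * b) (\<epsilon> * \<delta>) v"
  using assms unfolding vertices by (auto simp: algebra_simps)

lemma act_zero:
  assumes "v \<in> \<Union>triangles"
  shows "act 0 1 v = v"
  using assms unfolding vertices by auto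

text \<open>
  The image of \<open>rim 0\<close> determines the rotation and the image of \<open>rim 1\<close> the sign.
\<close>

lemma act_faithful:
  assumes ab: "a \<in> {0..<n}" "b \<in> {0..<n}" and signs: "\<epsilon> \<in> {1, -1}" "\<delta> \<in> {1, -1}"
    and eq: "\<forall>v \<in> \<Union>triangles. act a \<epsilon> v = act b \<delta> v"
  shows "a = b \<and> \<epsilon> = \<delta>"
proof -
  have eq': "rim (m * a + \<epsilon> * k) = rim (m * b + \<delta> * k)" for k
    using eq unfolding vertices by fastforce
  have "(m * a) mod (m * n) = (m * b) mod (m * n)"
    using eq'[of 0] unfolding rim_eq_iff by simp
  then have "a mod n = b mod n"
    unfolding mult_mod_right[symmetric] using m_pos by simp
  then have "a = b"
    using ab by simp
  moreover have "rim (m * a + 1) \<noteq> rim (m * a - 1)"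
    by (rule rim_neq) auto
  ultimately show ?thesis
    using eq'[of 1] signs by auto
qed

text \<open>
  An injective simplicial map embeds the star of the apex into the star of its image, which is too small
  for any other vertex.
\<close>

lemma simplicial_fixes_apex:
  assumes inj: "inj_on f (\<Union>triangles)" and T: "\<And>t. t \<in> triangles \<Longrightarrow> f ` t \<in> triangles"
  shows "f apex = apex"
proof (rule ccontr)
  assume neq: "f apex \<noteq> apex"
  have apex: "apex \<in> \<Union>triangles"
    unfolding vertices by blast
  have "inj_on (image f) {t \<in> triangles. apex \<in> t}"
    by (intro inj_onI) (metis (no_types, lifting) Union_upper inj inj_on_image_eq_iff mem_Collect_eq)
  moreover have "image f ` {t \<in> triangles. apex \<in> t} \<subseteq> {t \<in> triangles. f apex \<in> t}"
    using T by blast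
  ultimately have "card {t \<in> triangles. apex \<in> t} \<le> card {t \<in> triangles. f apex \<in> t}"
    using finite_T by (intro card_inj_on_le[of "image f"]) auto
  also have "card {t \<in> triangles. apex \<in> t} = nat (m * n)"
    using card_star[OF link_apex] by simp
  finally have le: "m * n \<le> int (card {t \<in> triangles. f apex \<in> t})"
    by linarith
  have "f apex \<in> \<Union>triangles"
    using apex T by blast
  then consider k where "f apex = rim k" | "f apex = nadir"
    using neq unfolding vertices by blast
  then show False
  proof cases
    case 1
    then show False
      using le link_rim[of k] card_star m_pos(4) by fastforce
  next
    case 2
    then have "card {t \<in> triangles. f apex \<in> t} = nat n"
      using card_star[OF link_nadir] by simp
    then show False
      using le mn by auto
  qed
qed

text \<open>
  The map acts on the link of the apex and so preserves adjacency on the rim. Once \<open>rim 0\<close> and \<open>rim 1\<close> have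
  been placed, injectivity leaves one choice for every further vertex: it cannot turn back.
\<close>

lemma simplicial_affine_on_rim:
  assumes inj: "inj_on f (\<Union>triangles)" and T: "\<And>t. t \<in> triangles \<Longrightarrow> f ` t \<in> triangles"
  shows "\<exists>b \<epsilon>. \<epsilon> \<in> {1, -1} \<and> (\<forall>k. f (rim k) = rim (b + \<epsilon> * k))"
proof -
  have apex: "f apex = apex"
    using simplicial_fixes_apex inj T .
  have inj': "f v = f w \<longleftrightarrow> v = w" if "v \<in> range rim \<union> {apex}" "w \<in> range rim \<union> {apex}" for v w
    using inj_on_eq_iff[OF inj, of v w] that unfolding vertices by blast
  have adjacent: "\<exists>l. {f (rim k), f (rim (k + 1))} = {rim l, rim (l + 1)}" for k
  proof -
    have "f ` {apex, rim k, rim (k + 1)} \<in> {t \<in> triangles. apex \<in> t}"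
      using T[OF apex_triangle[of k]] apex by simp
    then obtain l where "{apex, f (rim k), f (rim (k + 1))} = {apex, rim l, rim (l + 1)}"
      unfolding apex_star using apex by auto
    moreover have "f (rim k) \<noteq> apex" "f (rim (k + 1)) \<noteq> apex"
      using inj'[of "rim k" apex] inj'[of "rim (k + 1)" apex] unfolding apex by auto
    ultimately have "{f (rim k), f (rim (k + 1))} = {rim l, rim (l + 1)}"
      by (metis Diff_insert_absorb insertE insert_iff singletonD vertex_neq(2))
    then show ?thesis ..
  qed
  have next_rim: "f (rim (k + 1)) = rim (c + 1) \<or> f (rim (k + 1)) = rim (c - 1)"
    if c: "f (rim k) = rim c" for k c
  proof -
    obtain l where l: "{f (rim k), f (rim (k + 1))} = {rim l, rim (l + 1)}"
      using adjacent by blast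
    then consider "rim c = rim l" "f (rim (k + 1)) = rim (l + 1)"
      | "rim c = rim (l + 1)" "f (rim (k + 1)) = rim l"
      unfolding c doubleton_eq_iff by blast
    then show ?thesis
      using rim_shift[of c l 1] rim_shift'[of c "l + 1" 1] by cases auto
  qed
  obtain l where "{f (rim 0), f (rim (0 + 1))} = {rim l, rim (l + 1)}"
    using adjacent by blast
  then obtain b where b: "f (rim 0) = rim b"
    by blast
  then obtain \<epsilon> :: int where \<epsilon>: "\<epsilon> \<in> {1, -1}" "f (rim 1) = rim (b + \<epsilon>)"
    using next_rim[of 0 b] by fastforce
  have step: "f (rim (int k)) = rim (b + \<epsilon> * int k) \<and>
      f (rim (int k + 1)) = rim (b + \<epsilon> * (int k + 1))" for k :: nat
  proof (induction k)
    case 0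
    then show ?case
      using b \<epsilon> by simp
  next
    case (Suc k)
    let ?c = "b + \<epsilon> * (int k + 1)"
    have "rim (int k + 2) \<noteq> rim (int k)"
      by (rule rim_neq) auto
    then have "f (rim (int k + 2)) \<noteq> rim (b + \<epsilon> * int k)"
      using Suc inj' by (metis UnI1 rangeI)
    moreover have "f (rim (int k + 2)) = rim (?c + 1) \<or> f (rim (int k + 2)) = rim (?c - 1)"
      using next_rim[of "int k + 1" ?c] Suc by (simp add: add.assoc)
    ultimately have "f (rim (int k + 2)) = rim (b + \<epsilon> * (int k + 2))"
      using \<epsilon>(1) by (auto simp: algebra_simps)
    then show ?case
      using Suc by (simp add: add.commute)
  qed
  have "f (rim k) = rim (b + \<epsilon> * k)" for k
  proof -
    have "rim (int (nat (k mod (m * n)))) = rim k"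
      using m_pos unfolding rim_eq_iff by simp
    moreover have "rim (b + \<epsilon> * int (nat (k mod (m * n)))) = rim (b + \<epsilon> * k)"
      using m_pos unfolding rim_eq_iff by (simp, metis mod_add_right_eq mod_mult_right_eq)
    ultimately show ?thesis
      using step[of "nat (k mod (m * n))"] by metis
  qed
  then show ?thesis
    using \<epsilon>(1) by blast
qed

text \<open>
  The nadir is fixed because all other places are taken. Its neighbours are the corners, so the offset
  on the rim is a multiple of \<open>m\<close>. If \<open>m = 3\<close>, a reflection would map the second triangle of a sector,
  with positions \<open>0, 2, 0\<close>, to a triangle with positions \<open>0, 1, 0\<close>; but every fan triangle has a
  vertex at position \<open>2\<close>.
\<close>

lemma simplicial_is_act:
  assumes inj: "inj_on f (\<Union>triangles)" and T: "\<And>t. t \<in> triangles \<Longrightarrow> f ` t \<in> triangles"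
  shows "\<exists>a \<epsilon>. a \<in> {0..<n} \<and> (\<epsilon> = 1 \<or> \<epsilon> = -1 \<and> m = 2) \<and>
    (\<forall>v \<in> \<Union>triangles. f v = act a \<epsilon> v)"
proof -
  have apex: "f apex = apex"
    using simplicial_fixes_apex inj T .
  obtain b \<epsilon> where \<epsilon>: "\<epsilon> \<in> {1, -1}" and b: "\<And>k. f (rim k) = rim (b + \<epsilon> * k)"
    using simplicial_affine_on_rim[OF inj T] by blast
  have nadir_vertex: "nadir \<in> \<Union>triangles"
    unfolding vertices by blast
  then have "f nadir \<in> \<Union>triangles"
    using T by blast
  moreover have "f nadir \<noteq> f apex"
    using inj_on_eq_iff[OF inj, of nadir apex] unfolding vertices by simp
  moreover have "f nadir \<noteq> rim l" for l
  proof -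
    have "rim l = f (rim (\<epsilon> * (l - b)))"
      unfolding b using \<epsilon> by auto
    moreover have "f nadir \<noteq> f (rim (\<epsilon> * (l - b)))"
      using inj_on_eq_iff[OF inj, of nadir "rim (\<epsilon> * (l - b))"] unfolding vertices by simp
    ultimately show ?thesis
      by simp
  qed
  ultimately have nadir: "f nadir = nadir"
    using apex unfolding vertices by auto
  have "f ` {nadir, rim (m * 0), rim (m * 0 + m)} \<in> {t \<in> triangles. nadir \<in> t}"
    using T[OF nadir_triangle[of 0]] nadir by simp
  then obtain i where "f ` {nadir, rim (m * 0), rim (m * 0 + m)} = {nadir, rim (m * i), rim (m * i + m)}"
    unfolding nadir_star by blast
  then have "f (rim (m * 0)) \<in> {nadir, rim (m * i), rim (m * i + m)}"
    by blast
  then have "rim b = rim (m * i) \<or> rim b = rim (m * (i + 1))"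
    unfolding b by (simp add: algebra_simps)
  then obtain a where a: "rim b = rim (m * a)"
    by blast
  have f_rim: "f (rim k) = act a \<epsilon> (rim k)" for k
    unfolding b act_simps by (rule rim_shift[OF a])
  have f_act: "\<forall>v \<in> \<Union>triangles. f v = act (a mod n) \<epsilon> v"
    unfolding act_mod vertices using f_rim apex nadir by auto
  have "\<epsilon> = 1 \<or> \<epsilon> = -1 \<and> m = 2"
  proof (rule ccontr)
    assume "\<not> ?thesis"
    then have \<epsilon>': "\<epsilon> = -1" and m: "m = 3"
      using \<epsilon> mn by auto
    define t where "t = {rim (m * a), rim (m * a - 2), rim (m * a - 3)}"
    have "f ` fan 0 2 = t"
      unfolding fan_def t_def by (simp add: f_rim \<epsilon>')
    moreover have "f ` fan 0 2 \<in> triangles"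
      using m by (intro T fan_triangle) auto
    ultimately have "t \<in> triangles"
      by simp
    moreover have "apex \<notin> t" "nadir \<notin> t"
      unfolding t_def by auto
    ultimately obtain i j where j: "0 < j" "j < m" "t = fan i j"
      by (cases t rule: triangle_cases) auto
    have "j = 1 \<or> j = 2"
      using j(1,2) m by auto
    then have "rim (m * i + 2) \<in> t"
      unfolding j(3) fan_def by (auto simp: add.assoc)
    moreover have "m * (a - 1) = m * a - 3"
      using m by (simp add: algebra_simps)
    ultimately have "rim (m * i + 2) = rim (m * a + 0) \<or> rim (m * i + 2) = rim (m * (a - 1) + 1)
        \<or> rim (m * i + 2) = rim (m * (a - 1) + 0)"
      unfolding t_def by auto
    moreover have "rim (m * i + 2) \<noteq> rim (m * i' + j')" if "j' \<in> {0, 1}" for i' j'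
    proof
      assume "rim (m * i + 2) = rim (m * i' + j')"
      then have "2 = j'"
        by (rule rim_sector(1)) (use that m in auto)
      then show False
        using that by auto
    qed
    ultimately show False
      by (metis insertCI)
  qed
  moreover have "a mod n \<in> {0..<n}"
    using m_pos by simp
  ultimately show ?thesis
    using f_act by (intro exI[of _ "a mod n"] exI[of _ \<epsilon>] conjI)
qed

section \<open>A proper four-colouring\<close>

text \<open>
  The corners form a cycle of length \<open>n\<close>. It is coloured alternately by \<open>1\<close> and \<open>2\<close>, except for the last
  corner, which gets \<open>3\<close>; this covers odd \<open>n\<close> as well.
\<close>

definition corner_colour :: "int \<Rightarrow> int" where
  "corner_colour i = (if i mod n = n - 1 then 3 else 1 + (i mod n) mod 2)"

text \<open>
  The last rim vertex before the next corner gets the colour \<open>6 - a - b\<close>, the third one besides those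
  of the two corners of the sector. If \<open>m = 3\<close>, the remaining vertex gets the colour of the next corner,
  to which it is not adjacent. Colour \<open>0\<close> is left for apex and nadir, which are not adjacent.
\<close>

definition sector_colour :: "int \<Rightarrow> int \<Rightarrow> int" where
  "sector_colour i j = (if j = 0 then corner_colour i else if j < m - 1 then corner_colour (i + 1)
     else 6 - corner_colour i - corner_colour (i + 1))"

definition colour :: "nat \<Rightarrow> nat" where
  "colour v = (if v < apex then nat (sector_colour (int v div m) (int v mod m)) else 0)"

lemma corner_colour_range: "corner_colour i \<in> {1, 2, 3}"
  unfolding corner_colour_def by auto

lemma corner_colour_mod: "corner_colour (i mod n) = corner_colour i"
  unfolding corner_colour_def by simp

text \<open>
  Around the cycle parity changes from one corner to the next except at the last corner, which has a colour of its
  own. For \<open>n \<ge> 3\<close> its two neighbours are not coloured \<open>3\<close>.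
\<close>

lemma corner_colour_proper: "corner_colour i \<noteq> corner_colour (i + 1)"
proof -
  have range: "0 \<le> i mod n" "i mod n < n"
    using m_pos by auto
  have "(i + 1) mod n = (i mod n + 1) mod n"
    by (simp add: mod_simps)
  also have "\<dots> = (if i mod n = n - 1 then 0 else i mod n + 1)"
    using range by auto
  finally have next_index: "(i + 1) mod n = (if i mod n = n - 1 then 0 else i mod n + 1)" .
  have "k mod 2 \<noteq> (k + 1) mod 2" for k :: int
    by presburger
  from this[of "i mod n"] show ?thesis
    unfolding corner_colour_def next_index using m_pos(3) range by auto
qed

lemma colour_rim:
  assumes "0 \<le> j" "j < m"
  shows "colour (rim (m * i + j)) = nat (sector_colour i j)"
proof -
  have "(m * i + j) mod (m * n) = m * (i mod n) + j"
    using assms m_pos by (subst zmod_zmult2_eq) auto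
  then have sector: "int (rim (m * i + j)) div m = i mod n" "int (rim (m * i + j)) mod m = j"
    unfolding int_rim using assms by auto
  have "corner_colour (i mod n + 1) = corner_colour (i + 1)"
    by (metis corner_colour_mod mod_add_left_eq)
  then have "sector_colour (i mod n) j = sector_colour i j"
    unfolding sector_colour_def corner_colour_mod by simp
  then show ?thesis
    unfolding colour_def sector by (simp only: rim_less_apex if_True)
qed

lemma sector_colour_range: "sector_colour i j \<in> {1, 2, 3}"
  using corner_colour_range[of i] corner_colour_range[of "i + 1"] corner_colour_proper[of i]
  unfolding sector_colour_def by auto

lemma colour_rim_neq:
  assumes "0 \<le> j" "j < m" "0 \<le> j'" "j' < m" "sector_colour i j \<noteq> sector_colour i' j'"
  shows "colour (rim (m * i + j)) \<noteq> colour (rim (m * i' + j'))"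
  unfolding colour_rim[OF assms(1,2)] colour_rim[OF assms(3,4)]
  using sector_colour_range[of i j] sector_colour_range[of i' j'] assms(5) by auto

lemma colour_consecutive: "colour (rim k) \<noteq> colour (rim (k + 1))"
proof -
  obtain i j where j: "0 \<le> j" "j < m" "k = m * i + j"
    using rim_sector_cases .
  have c: "corner_colour i \<in> {1, 2, 3}" "corner_colour (i + 1) \<in> {1, 2, 3}"
    "corner_colour i \<noteq> corner_colour (i + 1)"
    using corner_colour_range corner_colour_proper by auto
  show ?thesis
  proof (cases "j = m - 1")
    case True
    have "sector_colour i j \<noteq> sector_colour (i + 1) 0"
      using c m_pos True unfolding sector_colour_def by auto
    then have "colour (rim (m * i + j)) \<noteq> colour (rim (m * (i + 1) + 0))"
      using j m_pos by (intro colour_rim_neq) auto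
    moreover have "m * (i + 1) + 0 = k + 1"
      using j(3) True by (simp add: algebra_simps)
    ultimately show ?thesis
      unfolding j(3)[symmetric] by metis
  next
    case False
    moreover have "6 - corner_colour i - corner_colour (i + 1) \<notin> {corner_colour i, corner_colour (i + 1)}"
      using c by (elim insertE emptyE) simp_all
    ultimately have "sector_colour i j \<noteq> sector_colour i (j + 1)"
      using c(3) j(1,2) m_pos(1,2) unfolding sector_colour_def by (smt (verit) insertCI)
    then have "colour (rim (m * i + j)) \<noteq> colour (rim (m * i + (j + 1)))"
      using j False by (intro colour_rim_neq) auto
    then show ?thesis
      unfolding j(3) add.assoc .
  qed
qed

lemma colour_corners: "colour (rim (m * i)) \<noteq> colour (rim (m * i + m))"
  using colour_rim_neq[of 0 0 i "i + 1"] corner_colour_proper[of i] m_pos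
  by (simp add: sector_colour_def algebra_simps)

lemma colour_fan:
  assumes "0 < j" "j < m"
  shows "colour (rim (m * i)) \<noteq> colour (rim (m * i + j))"
    "colour (rim (m * i)) \<noteq> colour (rim (m * i + j + 1))"
proof -
  have c: "corner_colour i \<in> {1, 2, 3}" "corner_colour (i + 1) \<in> {1, 2, 3}"
    "corner_colour i \<noteq> corner_colour (i + 1)"
    using corner_colour_range corner_colour_proper by auto
  have inner: "colour (rim (m * i)) \<noteq> colour (rim (m * i + j))" if "0 < j" "j < m" for j
  proof -
    have "sector_colour i 0 \<noteq> sector_colour i j"
      using that c unfolding sector_colour_def by auto
    then show ?thesis
      using colour_rim_neq[of 0 j i i] that by simp
  qed
  then show "colour (rim (m * i)) \<noteq> colour (rim (m * i + j))"
    using assms by blast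
  show "colour (rim (m * i)) \<noteq> colour (rim (m * i + j + 1))"
  proof (cases "j + 1 = m")
    case True
    then show ?thesis
      using colour_corners[of i] by (simp add: add.assoc)
  next
    case False
    then show ?thesis
      using inner[of "j + 1"] assms by (simp add: add.assoc)
  qed
qed

lemma colour_rim_pos: "0 < colour (rim k)"
proof -
  obtain i j where "0 \<le> j" "j < m" "k = m * i + j"
    using rim_sector_cases .
  then show ?thesis
    using colour_rim sector_colour_range[of i j] by auto
qed

lemma colour_proper:
  assumes "t \<in> triangles"
  shows "inj_on colour t"
proof -
  have pole: "colour apex = 0" "colour nadir = 0"
    unfolding colour_def nadir_def by auto
  have "colour (rim k) \<noteq> 0" for k
    using colour_rim_pos[of k] by simp
  note pole_neq = this this[THEN not_sym]
  show ?thesis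
    using assms
  proof (cases rule: triangle_cases)
    case (apex k)
    then show ?thesis
      using colour_consecutive[of k] pole pole_neq by (auto simp: inj_on_def)
  next
    case (nadir i)
    then show ?thesis
      using colour_corners[of i] pole pole_neq by (auto simp: inj_on_def)
  next
    case (fan i j)
    then show ?thesis
      using colour_fan[of j i] colour_consecutive[of "m * i + j"] unfolding fan_def inj_on_def by auto
  qed
qed

lemma colour_less_4: "colour v < 4"
proof (cases "v < apex")
  case True
  then show ?thesis
    using sector_colour_range[of "int v div m" "int v mod m"] unfolding colour_def by auto
qed (simp add: colour_def)

lemma embedding: "\<exists>\<phi>. equilateral_embedding (surface_of triangles) \<phi>"
  using four_colouring_embedding[of colour] colour_less_4 colour_proper by blast

end

section \<open>Realisation of the groups\<close>

lemma cyclic_realisation: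
  assumes "3 \<le> n"
  shows "\<exists>X :: nat incidence_structure. simplicial_surface X \<and> integer_mod_group n \<cong> Aut X \<and>
    (\<exists>\<phi>. equilateral_embedding X \<phi>)"
proof -
  interpret decorated_cone 3 "int n"
    using assms by unfold_locales auto
  have carrier: "carrier (integer_mod_group n) = {0..<int n}"
    using assms by (simp add: carrier_integer_mod_group)
  have "integer_mod_group n \<cong> Aut (surface_of triangles)"
  proof (rule Aut_iso_of_full_action[where \<rho> = "\<lambda>a. act a 1"])
    show "group (integer_mod_group n)"
      by (rule group_integer_mod_group)
    show "act \<one>\<^bsub>integer_mod_group n\<^esub> 1 v = v" if "v \<in> \<Union>triangles" for v
      using act_zero[OF that] by simp
    show "act (x \<otimes>\<^bsub>integer_mod_group n\<^esub> y) 1 v = act x 1 (act y 1 v)" if "v \<in> \<Union>triangles" for x y v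
      using act_act[OF that] act_mod by simp
    show "act x 1 ` t \<in> triangles" if "t \<in> triangles" for x t
      using rotation_simplicial[OF that] .
    show "x = y" if "x \<in> carrier (integer_mod_group n)" "y \<in> carrier (integer_mod_group n)"
      "\<forall>v \<in> \<Union>triangles. act x 1 v = act y 1 v" for x y
      using act_faithful that unfolding carrier by blast
    show "\<exists>x \<in> carrier (integer_mod_group n). \<forall>v \<in> \<Union>triangles. f v = act x 1 v"
      if f: "inj_on f (\<Union>triangles)" "\<And>t. t \<in> triangles \<Longrightarrow> f ` t \<in> triangles" for f
    proof -
      obtain a \<epsilon> where "a \<in> {0..<int n}" "\<epsilon> = 1 \<or> \<epsilon> = -1 \<and> (3::int) = 2"
        "\<forall>v \<in> \<Union>triangles. f v = act a \<epsilon> v"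
        using simplicial_is_act[OF f] by metis
      then show ?thesis
        unfolding carrier by auto
    qed
  qed
  then show ?thesis
    using simplicial_surface embedding by blast
qed

lemma dihedral_realisation:
  assumes "4 \<le> n"
  shows "\<exists>X :: nat incidence_structure. simplicial_surface X \<and> dihedral_group n \<cong> Aut X \<and>
    (\<exists>\<phi>. equilateral_embedding X \<phi>)"
proof -
  interpret decorated_cone 2 "int n"
    using assms by unfold_locales auto
  have carrier: "carrier (dihedral_group n) = {0..<int n} \<times> UNIV"
    using assms by (simp add: dihedral_group_def carrier_integer_mod_group)
  define sign :: "bool \<Rightarrow> int" where "sign s = (if s then -1 else 1)" for s
  have sign: "sign s \<in> {1, -1}" "sign (s \<noteq> t) = sign s * sign t" "sign s = sign t \<longleftrightarrow> s = t"
    "(if s then - b else b) = sign s * b" for s t b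
    unfolding sign_def by auto
  have mult: "(a, s) \<otimes>\<^bsub>dihedral_group n\<^esub> (b, t) = ((a + sign s * b) mod int n, s \<noteq> t)" for a s b t
    unfolding dihedral_group_def sign(4) by simp
  let ?\<rho> = "\<lambda>(a, s). act a (sign s)"
  have "dihedral_group n \<cong> Aut (surface_of triangles)"
  proof (rule Aut_iso_of_full_action[where \<rho> = ?\<rho>])
    show "group (dihedral_group n)"
      using assms by (intro group_dihedral_group) simp
    show "?\<rho> \<one>\<^bsub>dihedral_group n\<^esub> v = v" if "v \<in> \<Union>triangles" for v
      using act_zero[OF that] by (simp add: dihedral_group_def sign_def)
    show "?\<rho> (x \<otimes>\<^bsub>dihedral_group n\<^esub> y) v = ?\<rho> x (?\<rho> y v)" if "v \<in> \<Union>triangles" for x y v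
    proof (cases x; cases y)
      fix a s b t assume "x = (a, s)" "y = (b, t)"
      then show ?thesis
        by (simp only: mult prod.case act_mod sign(2) act_act[OF that])
    qed
    show "?\<rho> x ` t \<in> triangles" if "t \<in> triangles" for x t
      using rotation_simplicial[OF that] reflection_simplicial[OF _ that]
      by (cases x) (auto simp: sign_def)
    show "x = y" if "x \<in> carrier (dihedral_group n)" "y \<in> carrier (dihedral_group n)"
      "\<forall>v \<in> \<Union>triangles. ?\<rho> x v = ?\<rho> y v" for x y
    proof (cases x; cases y)
      fix a s b t assume "x = (a, s)" "y = (b, t)"
      then show ?thesis
        using act_faithful[of a b "sign s" "sign t"] that sign(1,3) unfolding carrier by auto
    qed
    show "\<exists>x \<in> carrier (dihedral_group n). \<forall>v \<in> \<Union>triangles. f v = ?\<rho> x v"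
      if f: "inj_on f (\<Union>triangles)" "\<And>t. t \<in> triangles \<Longrightarrow> f ` t \<in> triangles" for f
    proof -
      obtain a \<epsilon> where a: "a \<in> {0..<int n}" "\<epsilon> = 1 \<or> \<epsilon> = -1 \<and> (2::int) = 2"
        "\<forall>v \<in> \<Union>triangles. f v = act a \<epsilon> v"
        using simplicial_is_act[OF f] by metis
      moreover have "\<epsilon> = sign (\<epsilon> = -1)"
        using a(2) unfolding sign_def by auto
      ultimately show ?thesis
        unfolding carrier by (intro bexI[of _ "(a, \<epsilon> = -1)"]) auto
    qed
  qed
  then show ?thesis
    using simplicial_surface embedding by blast
qed

theorem theorem8p1:
  fixes G :: "('g, 'm) monoid_scheme" and n :: nat
  assumes "group G"
    and "n \<ge> 3 \<and> G \<cong> integer_mod_group n \<or> n \<ge> 4 \<and> G \<cong> dihedral_group n"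
  shows "\<exists>X :: nat incidence_structure.
    simplicial_surface X \<and> Aut X \<cong> G \<and> (\<exists>\<phi>. equilateral_embedding X \<phi>)"
proof -
  obtain X :: "nat incidence_structure" where X: "simplicial_surface X" "G \<cong> Aut X"
    "\<exists>\<phi>. equilateral_embedding X \<phi>"
    using assms(2) cyclic_realisation[of n] dihedral_realisation[of n] iso_trans by metis
  then show ?thesis
    using group.iso_sym[OF assms(1)] by blast
qed

end
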